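(* Let $V$ be a finite dimensional euclidean vector space over $\mathbf{R}$, let $1\le p<2$, and let $\gamma:[0,T]\to V$ be a continuous closed path ($\gamma(0)=\gamma(T)$) of finite $p$-variation. Let $x_1,x_2\in V^\ast$ be linearly independent and $\xi_1,\xi_2\in\mathbf{R}$ be such that $$\tfrac12<(x_1\circ\gamma-\xi_1)^2+(x_2\circ\gamma-\xi_2)^2<2\quad\text{on }[0,T].$$ Then $$W_\gamma(x_1\wedge x_2;\xi_1,\xi_2)=\frac{1}{2\pi}\sum_{n=0}^{\infty}\ \sum_{0\le k\le n}(-1)^k\binom{n}{k}\sum_{k_1+k_2=k}\frac{k!}{k_1!k_2!}\sum_{\substack{j_1^1+j_1^2=2k_1\\ j_2^1+j_2^2=2k_2}}\frac{(2k_1)!}{j_1^1!\,j_1^2!}\frac{(2k_2)!}{j_2^1!\,j_2^2!}\left\langle T^{j_1^1,j_1^2}_{j_2^1,j_2^2},X_\gamma\right\rangle ,$$ where the series in $n$ converges (for each $n$ the finite inner sums being computed first).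
   Context: All indices $k,k_1,k_2,j_a^b$ are nonnegative integers (superscripts on $j$ are labels, not powers). Line integrals along $\gamma$ are Young integrals (limits of Riemann–Stieltjes sums), which exist since $p<2$. Winding number: the $x_1\wedge x_2$-oriented winding number of the closed path $\gamma$ around the affine submanifold $\{x_1=\xi_1,x_2=\xi_2\}$ is $$W_\gamma(x_1\wedge x_2;\xi_1,\xi_2)=\frac1{2\pi}\int_\gamma\frac{(x_1-\xi_1)\,dx_2-(x_2-\xi_2)\,dx_1}{(x_1-\xi_1)^2+(x_2-\xi_2)^2}.$$ Signature: $X_\gamma$ is the formal series of tensors in $\widehat{\bigoplus}_{k\ge0}V^{\otimes k}$ whose degree $0$ component is $1$ and whose degree $k>0$ component is the iterated (Young) integral $\int_{0<t_1<\cdots<t_k<T}d\gamma_{t_1}\otimes\cdots\otimes d\gamma_{t_k}$. For a dual tensor $\tau$ (a finite sum of elements of the spaces $V^{\ast\otimes k}$), $\langle\tau,X_\gamma\rangle$ is the natural degree-by-degree pairing, with $\langle\phi_1\otimes\cdots\otimes\phi_k,v_1\otimes\cdots\otimes v_k\rangle=\prod_i\phi_i(v_i)$. The dual tensor $T^{j_1^1,j_1^2}_{j_2^1,j_2^2}\in V^{\ast\otimes(j_1^1+j_2^2+1)}\oplus V^{\ast\otimes(j_1^1+j_2^2+2)}$ is defined, with $c_i=x_i(\gamma(0))-\xi_i$, by $$T^{j_1^1,j_1^2}_{j_2^1,j_2^2}=c_1^{\,j_1^2}\,c_2^{\,j_2^1}\Big(\sum_{\sigma\in\mathfrak S_{j_1^1+j_2^2+1}}\big(\sigma[x_1^{\otimes(j_1^1+1)}\otimes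 x_2^{\otimes j_2^2}]\otimes x_2-\sigma[x_1^{\otimes j_1^1}\otimes x_2^{\otimes(j_2^2+1)}]\otimes x_1\big)$$ $$\qquad+c_1\sum_{\sigma\in\mathfrak S_{j_1^1+j_2^2}}\sigma[x_1^{\otimes j_1^1}\otimes x_2^{\otimes j_2^2}]\otimes x_2-c_2\sum_{\sigma\in\mathfrak S_{j_1^1+j_2^2}}\sigma[x_1^{\otimes j_1^1}\otimes x_2^{\otimes j_2^2}]\otimes x_1\Big),$$ where $\mathfrak S_m$ is the symmetric group, $\sigma[\cdot]$ permutes the $m$ tensor factors, $0^0=1$, and empty tensor products equal $1$. *)

theory Defs
  imports "HOL-Analysis.Analysis" "HOL-Combinatorics.Permutations"
begin

text \<open>
  \<^typ>\<open>'a::euclidean_space\<close> plays the role of \<open>V\<close>, and \<^typ>\<open>'a::euclidean_space \<Rightarrow>\<^sub>L real\<close> that of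
  the dual space; in finite dimension every linear form is bounded.
\<close>

definition finite_p_variation :: "real \<Rightarrow> real \<Rightarrow> (real \<Rightarrow> 'a::euclidean_space) \<Rightarrow> bool" where
  "finite_p_variation p T \<gamma> \<longleftrightarrow>
     (\<exists>C. \<forall>\<D>. \<D> division_of {0..T} \<longrightarrow>
        (\<Sum>K\<in>\<D>. norm (\<gamma> (Sup K) - \<gamma> (Inf K)) powr p) \<le> C)"

text \<open>
  The Young integral of an operator-valued integrand against a path is the limit of the
  Riemann--Stieltjes sums as the mesh of the tagged division tends to \<open>0\<close>. (As opposed to a
  Henstock--Kurzweil integral, the mesh bound is uniform.)  A library division may contain
  degenerate intervals \<open>{c}\<close>; these contribute \<open>0\<close>.
\<close>

definition has_young_integral ::
  "real \<Rightarrow> real \<Rightarrow> (real \<Rightarrow> 'a::euclidean_space \<Rightarrow>\<^sub>L real) \<Rightarrow> (real \<Rightarrow> 'a) \<Rightarrow> real \<Rightarrow> bool" where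
  "has_young_integral a b f \<gamma> I \<longleftrightarrow>
     (\<forall>\<epsilon>>0. \<exists>\<delta>>0. \<forall>P. P tagged_division_of {a..b} \<and> (\<forall>(s, K)\<in>P. Sup K - Inf K < \<delta>) \<longrightarrow>
        \<bar>(\<Sum>(s, K)\<in>P. blinfun_apply (f s) (\<gamma> (Sup K) - \<gamma> (Inf K))) - I\<bar> < \<epsilon>)"

definition young_integral ::
  "real \<Rightarrow> real \<Rightarrow> (real \<Rightarrow> 'a::euclidean_space \<Rightarrow>\<^sub>L real) \<Rightarrow> (real \<Rightarrow> 'a) \<Rightarrow> real" where
  "young_integral a b f \<gamma> = (THE I. has_young_integral a b f \<gamma> I)"

lemma has_young_integral_unique:
  assumes "a \<le> b" and "has_young_integral a b f \<gamma> I" and "has_young_integral a b f \<gamma> J"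
  shows "I = J"
proof (rule ccontr)
  assume "I \<noteq> J"
  define e where "e = \<bar>I - J\<bar> / 2"
  have e: "e > 0" using \<open>I \<noteq> J\<close> by (simp add: e_def)
  let ?S = "\<lambda>P. (\<Sum>(s, K)\<in>P. blinfun_apply (f s) (\<gamma> (Sup K) - \<gamma> (Inf K)))"
  obtain d1 where d1: "d1 > 0" "\<And>P. P tagged_division_of {a..b} \<Longrightarrow>
      (\<forall>(s, K)\<in>P. Sup K - Inf K < d1) \<Longrightarrow> \<bar>?S P - I\<bar> < e"
    using assms(2) e unfolding has_young_integral_def by meson
  obtain d2 where d2: "d2 > 0" "\<And>P. P tagged_division_of {a..b} \<Longrightarrow>
      (\<forall>(s, K)\<in>P. Sup K - Inf K < d2) \<Longrightarrow> \<bar>?S P - J\<bar> < e"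
    using assms(3) e unfolding has_young_integral_def by meson
  define d where "d = min d1 d2 / 3"
  have d: "d > 0" using d1(1) d2(1) by (simp add: d_def)
  have "gauge (\<lambda>x::real. ball x d)"
    using d by (rule gauge_ball)
  then obtain P where P: "P tagged_division_of {a..b}" "(\<lambda>x. ball x d) fine P"
    by (metis fine_division_exists box_real(2))
  have mesh: "Sup K - Inf K < min d1 d2" if sK: "(s, K) \<in> P" for s K
  proof -
    obtain u v where K: "K = {u..v}"
      using tagged_division_ofD(4)[OF P(1) sK] by auto
    have "s \<in> K" using tagged_division_ofD(2)[OF P(1) sK] .
    then have uv: "u \<le> v" using K by simp
    have "K \<subseteq> ball s d" using P(2) sK by (rule fineD)
    then have "dist s u < d" "dist s v < d" using K uv by auto
    then have "v - u < min d1 d2"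
      using d unfolding dist_real_def d_def by linarith
    then show ?thesis using K uv by simp
  qed
  have "\<bar>?S P - I\<bar> < e" by (rule d1(2)[OF P(1)]) (use mesh in fastforce)
  moreover have "\<bar>?S P - J\<bar> < e" by (rule d2(2)[OF P(1)]) (use mesh in fastforce)
  ultimately show False unfolding e_def by (smt (verit) field_sum_of_halves)
qed

lemma young_integral_eqI:
  assumes "a \<le> b" and "has_young_integral a b f \<gamma> I"
  shows "young_integral a b f \<gamma> = I"
  unfolding young_integral_def
  using assms has_young_integral_unique by blast

definition line_integral ::
  "real \<Rightarrow> (real \<Rightarrow> 'a::euclidean_space) \<Rightarrow> ('a \<Rightarrow> 'a \<Rightarrow>\<^sub>L real) \<Rightarrow> real" where
  "line_integral T \<gamma> \<omega> = young_integral 0 T (\<lambda>t. \<omega> (\<gamma> t)) \<gamma>"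

text \<open>The differential of a linear form \<open>x\<close> is \<open>x\<close> itself, at every point.\<close>

definition winding_form ::
  "('a::euclidean_space \<Rightarrow>\<^sub>L real) \<Rightarrow> ('a \<Rightarrow>\<^sub>L real) \<Rightarrow> real \<Rightarrow> real \<Rightarrow> 'a \<Rightarrow> 'a \<Rightarrow>\<^sub>L real" where
  "winding_form x\<^sub>1 x\<^sub>2 \<xi>\<^sub>1 \<xi>\<^sub>2 v =
     (1 / ((x\<^sub>1 v - \<xi>\<^sub>1)\<^sup>2 + (x\<^sub>2 v - \<xi>\<^sub>2)\<^sup>2)) *\<^sub>R ((x\<^sub>1 v - \<xi>\<^sub>1) *\<^sub>R x\<^sub>2 - (x\<^sub>2 v - \<xi>\<^sub>2) *\<^sub>R x\<^sub>1)"

definition oriented_winding_number ::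
  "real \<Rightarrow> (real \<Rightarrow> 'a::euclidean_space) \<Rightarrow> ('a \<Rightarrow>\<^sub>L real) \<Rightarrow> ('a \<Rightarrow>\<^sub>L real) \<Rightarrow> real \<Rightarrow> real \<Rightarrow> real" where
  "oriented_winding_number T \<gamma> x\<^sub>1 x\<^sub>2 \<xi>\<^sub>1 \<xi>\<^sub>2 =
     1 / (2 * pi) * line_integral T \<gamma> (winding_form x\<^sub>1 x\<^sub>2 \<xi>\<^sub>1 \<xi>\<^sub>2)"

text \<open>
  Tensors are modelled by their values on words of vectors.  A formal series of tensors over \<open>V\<close> is
  given by its coordinates: its value at the word \<open>[b\<^sub>1, \<dots>, b\<^sub>k]\<close> over \<^term>\<open>Basis\<close> is the
  coefficient of \<open>b\<^sub>1 \<otimes> \<dots> \<otimes> b\<^sub>k\<close>.  A dual tensor is a family of multilinear forms: its value at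
  \<open>[v\<^sub>1, \<dots>, v\<^sub>k]\<close> is its degree \<open>k\<close> component evaluated at \<open>(v\<^sub>1, \<dots>, v\<^sub>k)\<close>.  The pairing is the sum
  over all basis words; only finitely many of them contribute, a dual tensor having finitely many
  nonzero degrees.
\<close>

type_synonym 'a tensor = "'a list \<Rightarrow> real"

definition vec_tensor :: "'a::euclidean_space list \<Rightarrow> 'a tensor" where
  "vec_tensor vs = (\<lambda>w. if length w = length vs then \<Prod>i<length vs. (vs ! i) \<bullet> (w ! i) else 0)"

definition dual_tensor :: "('a::euclidean_space \<Rightarrow>\<^sub>L real) list \<Rightarrow> 'a tensor" where
  "dual_tensor \<phi>s = (\<lambda>w. if length w = length \<phi>s then \<Prod>i<length \<phi>s. (\<phi>s ! i) (w ! i) else 0)"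

definition pairing :: "'a::euclidean_space tensor \<Rightarrow> 'a tensor \<Rightarrow> real" where
  "pairing \<tau> X = (\<Sum>w | set w \<subseteq> Basis \<and> \<tau> w \<noteq> 0. \<tau> w * X w)"

lemma pairing_dual_tensor:
  "pairing (dual_tensor \<phi>s) X =
     (\<Sum>w | set w \<subseteq> Basis \<and> length w = length \<phi>s. (\<Prod>i<length \<phi>s. (\<phi>s ! i) (w ! i)) * X w)"
  unfolding pairing_def
proof (rule sum.mono_neutral_cong_left)
  show "finite {w. set w \<subseteq> (Basis :: 'a set) \<and> length w = length \<phi>s}"
    by (rule finite_lists_length_eq) simp
qed (auto simp: dual_tensor_def split: if_splits)

lemma pairing_dual_tensor_vec_tensor:
  assumes "length vs = length \<phi>s"
  shows "pairing (dual_tensor \<phi>s) (vec_tensor vs) = (\<Prod>i<length \<phi>s. (\<phi>s ! i) (vs ! i))"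
proof -
  have "(\<Sum>w | set w \<subseteq> Basis \<and> length w = length \<phi>s.
          (\<Prod>i<length \<phi>s. (\<phi>s ! i) (w ! i)) * (\<Prod>i<length \<phi>s. (vs ! i) \<bullet> (w ! i))) =
        (\<Prod>i<length \<phi>s. (\<phi>s ! i) (vs ! i))"
    using assms
  proof (induction vs \<phi>s rule: list_induct2)
    case Nil
    have "{w. set w \<subseteq> Basis \<and> length w = length []} = {[] :: 'a list}" by auto
    then show ?case by simp
  next
    case (Cons v vs \<phi> \<phi>s)
    let ?n = "length \<phi>s"
    let ?W = "\<lambda>n. {w. set w \<subseteq> (Basis :: 'a set) \<and> length w = n}"
    have W: "?W (Suc ?n) = (\<lambda>(b, w). b # w) ` (Basis \<times> ?W ?n)"
      by (force simp: length_Suc_conv)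
    have inj: "inj_on (\<lambda>(b, w). b # w) (Basis \<times> ?W ?n)"
      by (auto simp: inj_on_def)
    have \<phi>: "(\<Sum>b\<in>Basis. \<phi> b * (v \<bullet> b)) = \<phi> v"
    proof -
      have "\<phi> v = \<phi> (\<Sum>b\<in>Basis. (v \<bullet> b) *\<^sub>R b)" by (simp add: euclidean_representation)
      also have "\<dots> = (\<Sum>b\<in>Basis. \<phi> b * (v \<bullet> b))"
        by (simp add: blinfun.sum_right blinfun.scaleR_right mult.commute)
      finally show ?thesis ..
    qed
    have "(\<Sum>w\<in>?W (Suc ?n). (\<Prod>i<Suc ?n. ((\<phi> # \<phi>s) ! i) (w ! i)) *
              (\<Prod>i<Suc ?n. ((v # vs) ! i) \<bullet> (w ! i))) =
          (\<Sum>(b, w)\<in>Basis \<times> ?W ?n. (\<phi> b * (v \<bullet> b)) *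
              ((\<Prod>i<?n. (\<phi>s ! i) (w ! i)) * (\<Prod>i<?n. (vs ! i) \<bullet> (w ! i))))"
      unfolding W sum.reindex[OF inj]
      by (intro sum.cong refl) (auto simp: prod.lessThan_Suc_shift mult_ac simp del: prod.lessThan_Suc)
    also have "\<dots> = (\<Sum>b\<in>Basis. \<phi> b * (v \<bullet> b)) *
        (\<Sum>w\<in>?W ?n. (\<Prod>i<?n. (\<phi>s ! i) (w ! i)) * (\<Prod>i<?n. (vs ! i) \<bullet> (w ! i)))"
      by (simp add: sum.cartesian_product[symmetric] sum_product)
    also have "\<dots> = \<phi> v * (\<Prod>i<?n. (\<phi>s ! i) (vs ! i))"
      using Cons.IH \<phi> by simp
    finally show ?case by (simp add: prod.lessThan_Suc_shift del: prod.lessThan_Suc)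
  qed
  then show ?thesis
    unfolding pairing_dual_tensor using assms by (simp add: vec_tensor_def)
qed

text \<open>
  \<open>iterated_integral \<gamma> [b\<^sub>k, \<dots>, b\<^sub>1] t\<close> is the integral of \<open>d\<langle>\<gamma>, b\<^sub>1\<rangle>\<^bsub>t\<^sub>1\<^esub> \<dots> d\<langle>\<gamma>, b\<^sub>k\<rangle>\<^bsub>t\<^sub>k\<^esub>\<close> over
  \<open>0 < t\<^sub>1 < \<dots> < t\<^sub>k < t\<close>.  The outermost integration is the one in \<open>t\<^sub>k\<close>, whence the reversal of the
  word.
\<close>

primrec iterated_integral :: "(real \<Rightarrow> 'a::euclidean_space) \<Rightarrow> 'a list \<Rightarrow> real \<Rightarrow> real" where
  "iterated_integral \<gamma> [] = (\<lambda>t. 1)"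
| "iterated_integral \<gamma> (b # w) =
     (\<lambda>t. young_integral 0 t (\<lambda>s. iterated_integral \<gamma> w s *\<^sub>R blinfun_inner_left b) \<gamma>)"

definition signature :: "real \<Rightarrow> (real \<Rightarrow> 'a::euclidean_space) \<Rightarrow> 'a tensor" where
  "signature T \<gamma> = (\<lambda>w. iterated_integral \<gamma> (rev w) T)"

text \<open>
  In \<open>T_tensor x\<^sub>1 x\<^sub>2 c\<^sub>1 c\<^sub>2 j11 j12 j21 j22\<close> the index \<open>jab\<close> has subscript \<open>a\<close> and superscript \<open>b\<close>.
\<close>

definition T_tensor ::
  "('a::euclidean_space \<Rightarrow>\<^sub>L real) \<Rightarrow> ('a \<Rightarrow>\<^sub>L real) \<Rightarrow> real \<Rightarrow> real \<Rightarrow> nat \<Rightarrow> nat \<Rightarrow> nat \<Rightarrow> nat \<Rightarrow> 'a tensor"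
  where
  "T_tensor x\<^sub>1 x\<^sub>2 c\<^sub>1 c\<^sub>2 j11 j12 j21 j22 = (\<lambda>w.
     c\<^sub>1 ^ j12 * c\<^sub>2 ^ j21 *
     ((\<Sum>\<sigma> | \<sigma> permutes {..<j11 + j22 + 1}.
          dual_tensor (permute_list \<sigma> (replicate (j11 + 1) x\<^sub>1 @ replicate j22 x\<^sub>2) @ [x\<^sub>2]) w
        - dual_tensor (permute_list \<sigma> (replicate j11 x\<^sub>1 @ replicate (j22 + 1) x\<^sub>2) @ [x\<^sub>1]) w)
      + c\<^sub>1 * (\<Sum>\<sigma> | \<sigma> permutes {..<j11 + j22}.
          dual_tensor (permute_list \<sigma> (replicate j11 x\<^sub>1 @ replicate j22 x\<^sub>2) @ [x\<^sub>2]) w)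
      - c\<^sub>2 * (\<Sum>\<sigma> | \<sigma> permutes {..<j11 + j22}.
          dual_tensor (permute_list \<sigma> (replicate j11 x\<^sub>1 @ replicate j22 x\<^sub>2) @ [x\<^sub>1]) w)))"

definition winding_series_term ::
  "real \<Rightarrow> (real \<Rightarrow> 'a::euclidean_space) \<Rightarrow> ('a \<Rightarrow>\<^sub>L real) \<Rightarrow> ('a \<Rightarrow>\<^sub>L real) \<Rightarrow> real \<Rightarrow> real \<Rightarrow> nat \<Rightarrow> real"
  where
  "winding_series_term T \<gamma> x\<^sub>1 x\<^sub>2 \<xi>\<^sub>1 \<xi>\<^sub>2 n =
     (\<Sum>k\<le>n. (-1) ^ k * real (n choose k) *
       (\<Sum>(k\<^sub>1, k\<^sub>2) \<in> {(k\<^sub>1, k\<^sub>2). k\<^sub>1 + k\<^sub>2 = k}. fact k / (fact k\<^sub>1 * fact k\<^sub>2) *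
         (\<Sum>((j11, j12), (j21, j22)) \<in> {(j11, j12). j11 + j12 = 2 * k\<^sub>1} \<times> {(j21, j22). j21 + j22 = 2 * k\<^sub>2}.
           fact (2 * k\<^sub>1) / (fact j11 * fact j12) * (fact (2 * k\<^sub>2) / (fact j21 * fact j22)) *
           pairing (T_tensor x\<^sub>1 x\<^sub>2 (x\<^sub>1 (\<gamma> 0) - \<xi>\<^sub>1) (x\<^sub>2 (\<gamma> 0) - \<xi>\<^sub>2) j11 j12 j21 j22)
             (signature T \<gamma>))))"

end

theory Submission
  imports Defs
begin

text \<open>
  Write \<open>y\<^sub>i = x\<^sub>i(\<gamma>) - \<xi>\<^sub>i\<close> and \<open>r = y\<^sub>1\<^sup>2 + y\<^sub>2\<^sup>2\<close>.  As \<open>\<bar>1 - r\<bar> < 1\<close> on the annulus, the weight of the winding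
  form is a geometric series, \<open>1 / r = (\<Sum>n. (1 - r) ^ n)\<close>.  By the binomial theorem each \<open>(1 - r) ^ n\<close>
  is a polynomial in the increments \<open>z\<^sub>i = x\<^sub>i(\<gamma>(t) - \<gamma>(0))\<close>, and a monomial \<open>z\<^sub>1\<^sup>a z\<^sub>2\<^sup>b\<close> is a linear
  functional of the signature: it is the sum over all permutations of \<open>x\<^sub>1\<^sup>\<otimes>\<^sup>a \<otimes> x\<^sub>2\<^sup>\<otimes>\<^sup>b\<close>
  (\<open>sum_permutations_signature_form\<close>).  One more letter at the end of the word is one more
  integration, so the \<open>n\<close>-th term of the series is the line integral of
  \<open>(1 - r) ^ n *\<^sub>R (y\<^sub>1 *\<^sub>R x\<^sub>2 - y\<^sub>2 *\<^sub>R x\<^sub>1)\<close> (\<open>winding_series_term_primitive\<close>).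

  The analysis is Young's theory, in the form of a differential calculus.  From the
  \<open>p\<close>-variation one gets a superadditive control \<open>\<omega>\<close> of the path: \<open>norm (\<gamma> v - \<gamma> u) \<le> \<omega> u v powr (\<theta> / 2)\<close>
  with \<open>\<theta> > 1\<close>.  A function \<open>F\<close> is a primitive of \<open>f d\<gamma>\<close> if \<open>F v - F u - f s (\<gamma> v - \<gamma> u)\<close> is
  at most a constant times \<open>\<omega> u v powr \<theta>\<close>; since the sum of these errors over a division tends to
  \<open>0\<close> with the mesh, the increments of \<open>F\<close> are then Young integrals.  Primitives obey the product
  rule, from which the permutation identity follows by induction on the degree.  That every
  integrand which is itself bounded by \<open>\<omega> u v powr (\<theta> / 2)\<close> on increments has a primitive is the sewing lemma.

  The sewing lemma also bounds the integral by the constant in the increment bound of the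
  integrand.  For the remainder \<open>(1 - r) ^ N / r\<close> of the geometric series, with \<open>\<bar>1 - r\<bar> \<le> \<rho> < 1\<close>, that
  constant is of order \<open>N * \<rho> ^ (N - 1)\<close>; this gives the convergence (\<open>winding_series_sums\<close>).
\<close>

section \<open>The sewing lemma\<close>

text \<open>
  In the application \<open>\<omega> u v\<close> dominates the \<open>q\<close>-th powers of the increments of the path between \<open>u\<close>
  and \<open>v\<close>, for some \<open>q < 2\<close>, and \<open>\<theta> = 2 / q\<close>: a product of two increments is of order \<open>\<omega> u v powr \<theta>\<close>.
\<close>

locale superadditive_control =
  fixes \<omega> :: "real \<Rightarrow> real \<Rightarrow> real" and T \<theta> :: real
  assumes T_nonneg: "0 \<le> T" and \<theta>_gt_1: "1 < \<theta>"
    and control_nonneg: "0 \<le> u \<Longrightarrow> u \<le> v \<Longrightarrow> v \<le> T \<Longrightarrow> 0 \<le> \<omega> u v"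
    and control_superadditive:
      "0 \<le> u \<Longrightarrow> u \<le> w \<Longrightarrow> w \<le> v \<Longrightarrow> v \<le> T \<Longrightarrow> \<omega> u w + \<omega> w v \<le> \<omega> u v"
begin

lemma control_refl: "0 \<le> u \<Longrightarrow> u \<le> T \<Longrightarrow> \<omega> u u = 0"
  using control_superadditive[of u u u] control_nonneg[of u u] by simp

lemma control_mono:
  assumes "0 \<le> u" "u \<le> u'" "u' \<le> v'" "v' \<le> v" "v \<le> T"
  shows "\<omega> u' v' \<le> \<omega> u v"
  using control_superadditive[of u u' v] control_superadditive[of u' v' v]
    control_nonneg[of u u'] control_nonneg[of v' v] assms by linarith

text \<open>
  The solution \<open>C\<close> of \<open>2 powr (1 - \<theta>) * C + 2 = C\<close>.  It is the constant reproduced by the halving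
  argument below: two halves contribute \<open>2 * C * (1 / 2) powr \<theta>\<close>, and two comparisons contribute \<open>2\<close>.
\<close>

definition sewing_constant :: real where
  "sewing_constant = 2 / (1 - 2 powr (1 - \<theta>))"

lemma two_powr_lt_1: "2 powr (1 - \<theta>) < 1"
  using \<theta>_gt_1 by (simp add: powr_less_one)

lemma sewing_constant_pos: "0 < sewing_constant"
  using two_powr_lt_1 by (simp add: sewing_constant_def)

lemma sewing_constant_eq: "2 powr (1 - \<theta>) * sewing_constant + 2 = sewing_constant"
proof -
  have "x * (2 / (1 - x)) + 2 = 2 / (1 - x)" if "x < 1" for x :: real
    using that by (simp add: field_simps)
  from this[OF two_powr_lt_1] show ?thesis unfolding sewing_constant_def .
qed

text \<open>
  The sum over a partition cannot drift away from the coarse value, however fine the partition.  The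
  partition is cut at the interval where the control, accumulated from the left, passes half
  of its total.  By superadditivity both remaining pieces have at most half of the control, so the
  induction hypothesis applies to them with the gain \<open>2 * (1 / 2) powr \<theta> < 1\<close>; joining the two pieces
  and the interval between them takes two comparisons.
\<close>

lemma sewing_maximal_inequality:
  fixes \<Xi> :: "real \<Rightarrow> real \<Rightarrow> real" and t :: "nat \<Rightarrow> real"
  assumes \<Xi>: "\<And>u w v. 0 \<le> u \<Longrightarrow> u \<le> w \<Longrightarrow> w \<le> v \<Longrightarrow> v \<le> T \<Longrightarrow>
             \<bar>\<Xi> u v - \<Xi> u w - \<Xi> w v\<bar> \<le> K * \<omega> u v powr \<theta>"
    and K: "0 \<le> K"
    and "m \<le> n" "0 \<le> t m" "t n \<le> T"
    and "\<And>i j. m \<le> i \<Longrightarrow> i \<le> j \<Longrightarrow> j \<le> n \<Longrightarrow> t i \<le> t j"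
  shows "\<bar>(\<Sum>i=m..<n. \<Xi> (t i) (t (Suc i))) - \<Xi> (t m) (t n)\<bar> \<le>
           sewing_constant * K * \<omega> (t m) (t n) powr \<theta>"
  using assms(3-)
proof (induction "n - m" arbitrary: m n rule: less_induct)
  case less
  note mono = less.prems(4)
  show ?case
  proof (cases "m = n")
    case True
    with less.prems have "0 \<le> t m" "t m \<le> T" by auto
    then have "\<bar>\<Xi> (t m) (t m)\<bar> \<le> 0"
      using \<Xi>[of "t m" "t m" "t m"] \<theta>_gt_1 by (simp add: control_refl)
    with True show ?thesis using K sewing_constant_pos by simp
  next
    case False
    with less.prems have mn: "m < n" by simp
    have range: "0 \<le> t i" "t i \<le> T" if "m \<le> i" "i \<le> n" for i
      using mono[of m i] mono[of i n] that less.prems by linarith+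
    define \<Omega> where "\<Omega> = \<omega> (t m) (t n)"
    have \<Omega>: "0 \<le> \<Omega>"
      unfolding \<Omega>_def using less.prems mono[of m n] by (intro control_nonneg) auto
    \<comment> \<open>\<open>{t j..t (j + 1)}\<close> is the interval at which the control passes half of its total.\<close>
    define J where "J = {j. m \<le> j \<and> j < n \<and> \<omega> (t m) (t j) \<le> \<Omega> / 2}"
    define j where "j = Max J"
    have finJ: "finite J" unfolding J_def by simp
    have "m \<in> J" using mn \<Omega> range[of m] by (simp add: J_def control_refl)
    then have jJ: "j \<in> J" and jmax: "\<And>i. i \<in> J \<Longrightarrow> i \<le> j"
      unfolding j_def using finJ by (auto intro: Max_in)
    then have j: "m \<le> j" "j < n" "\<omega> (t m) (t j) \<le> \<Omega> / 2" by (auto simp: J_def)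
    have right: "\<omega> (t (Suc j)) (t n) \<le> \<Omega> / 2"
    proof (cases "Suc j = n")
      case True
      with \<Omega> range[of n] mn show ?thesis by (simp add: control_refl)
    next
      case False
      have "Suc j \<notin> J" using jmax[of "Suc j"] by auto
      then have "\<omega> (t m) (t (Suc j)) > \<Omega> / 2" using False j by (auto simp: J_def)
      moreover have "\<omega> (t m) (t (Suc j)) + \<omega> (t (Suc j)) (t n) \<le> \<Omega>"
        unfolding \<Omega>_def using j less.prems mono[of m "Suc j"] mono[of "Suc j" n]
        by (intro control_superadditive) auto
      ultimately show ?thesis by linarith
    qed
    have half: "sewing_constant * K * \<omega> (t a) (t b) powr \<theta> \<le> sewing_constant * K * (\<Omega> / 2) powr \<theta>"
      if "\<omega> (t a) (t b) \<le> \<Omega> / 2" "m \<le> a" "a \<le> b" "b \<le> n" for a b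
      using that K sewing_constant_pos \<theta>_gt_1 range mono[of a b]
      by (intro mult_left_mono powr_mono2 control_nonneg) auto
    have part1: "\<bar>(\<Sum>i=m..<j. \<Xi> (t i) (t (Suc i))) - \<Xi> (t m) (t j)\<bar> \<le>
        sewing_constant * K * (\<Omega> / 2) powr \<theta>"
      using less.hyps[of j m] j less.prems mono range[of j] half[of m j] by force
    have part2: "\<bar>(\<Sum>i=Suc j..<n. \<Xi> (t i) (t (Suc i))) - \<Xi> (t (Suc j)) (t n)\<bar> \<le>
        sewing_constant * K * (\<Omega> / 2) powr \<theta>"
      using less.hyps[of n "Suc j"] j less.prems mono range[of "Suc j"] half[of "Suc j" n] right by force
    have "\<bar>\<Xi> (t m) (t n) - \<Xi> (t m) (t j) - \<Xi> (t j) (t n)\<bar> \<le> K * \<Omega> powr \<theta>"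
      unfolding \<Omega>_def using j less.prems mono by (intro \<Xi>) auto
    moreover have "\<bar>\<Xi> (t j) (t n) - \<Xi> (t j) (t (Suc j)) - \<Xi> (t (Suc j)) (t n)\<bar> \<le> K * \<Omega> powr \<theta>"
    proof -
      have "\<omega> (t j) (t n) \<le> \<Omega>"
        unfolding \<Omega>_def using j less.prems mono by (intro control_mono) auto
      then have "K * \<omega> (t j) (t n) powr \<theta> \<le> K * \<Omega> powr \<theta>"
        using j range[of j] range[of n] mono[of j n] K \<theta>_gt_1
        by (intro mult_left_mono powr_mono2 control_nonneg) auto
      moreover have "\<bar>\<Xi> (t j) (t n) - \<Xi> (t j) (t (Suc j)) - \<Xi> (t (Suc j)) (t n)\<bar>
          \<le> K * \<omega> (t j) (t n) powr \<theta>"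
        using j range[of j] less.prems mono by (intro \<Xi>) auto
      ultimately show ?thesis by linarith
    qed
    moreover have "(\<Sum>i=m..<n. \<Xi> (t i) (t (Suc i))) =
        (\<Sum>i=m..<j. \<Xi> (t i) (t (Suc i))) + \<Xi> (t j) (t (Suc j)) + (\<Sum>i=Suc j..<n. \<Xi> (t i) (t (Suc i)))"
      using j by (simp flip: sum.atLeastLessThan_concat[of m j n] add: sum.atLeast_Suc_lessThan[of j n])
    ultimately have "\<bar>(\<Sum>i=m..<n. \<Xi> (t i) (t (Suc i))) - \<Xi> (t m) (t n)\<bar> \<le>
        2 * (sewing_constant * K * (\<Omega> / 2) powr \<theta>) + 2 * (K * \<Omega> powr \<theta>)"
      using part1 part2 by linarith
    also have "\<dots> = (2 powr (1 - \<theta>) * sewing_constant + 2) * K * \<Omega> powr \<theta>"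
      by (simp add: powr_divide powr_diff field_simps)
    also have "\<dots> = sewing_constant * K * \<Omega> powr \<theta>"
      by (simp only: sewing_constant_eq)
    finally show ?thesis by (simp add: \<Omega>_def)
  qed
qed

text \<open>
  The partial sums of \<open>\<Xi>\<close> along the enumeration of the finite set satisfy all constraints at once,
  by the maximal inequality.
\<close>

lemma sewing_on_finite_set:
  fixes \<Xi> :: "real \<Rightarrow> real \<Rightarrow> real"
  assumes \<Xi>: "\<And>u w v. 0 \<le> u \<Longrightarrow> u \<le> w \<Longrightarrow> w \<le> v \<Longrightarrow> v \<le> T \<Longrightarrow>
             \<bar>\<Xi> u v - \<Xi> u w - \<Xi> w v\<bar> \<le> K * \<omega> u v powr \<theta>"
    and K: "0 \<le> K"
    and D: "finite D" "D \<subseteq> {0..T}"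
  shows "\<exists>F. \<forall>u\<in>D. \<forall>v\<in>D. u \<le> v \<longrightarrow>
    \<bar>F v - F u - \<Xi> u v\<bar> \<le> sewing_constant * K * \<omega> u v powr \<theta>"
proof -
  define t where "t i = sorted_list_of_set D ! i" for i
  have inj: "inj_on t {..<card D}"
    unfolding t_def by (auto simp: inj_on_def nth_eq_iff_index_eq)
  have surj: "D = t ` {..<card D}"
    using D(1) unfolding t_def
    by (metis image_image lessThan_atLeast0 length_sorted_list_of_set list.set_map map_nth
        set_sorted_list_of_set set_upt)
  have mono: "t i \<le> t j" if "i \<le> j" "j < card D" for i j
    unfolding t_def using that sorted_sorted_list_of_set by (intro sorted_nth_mono) auto
  define F where "F x = (\<Sum>i<inv_into {..<card D} t x. \<Xi> (t i) (t (Suc i)))" for x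
  show ?thesis
  proof (intro exI[of _ F] ballI impI)
    fix u v assume uv: "u \<in> D" "v \<in> D" "u \<le> v"
    obtain m n where mn: "u = t m" "m < card D" "v = t n" "n < card D"
      using uv(1,2) equalityD1[OF surj] by blast
    have "m \<le> n"
    proof (rule ccontr)
      assume "\<not> m \<le> n"
      then have "t n \<le> t m" using mono[of n m] mn by simp
      then have "t n = t m" using uv mn by simp
      then show False using inj mn \<open>\<not> m \<le> n\<close> by (auto dest: inj_onD)
    qed
    have F: "F (t i) = (\<Sum>i<i. \<Xi> (t i) (t (Suc i)))" if "i < card D" for i
      unfolding F_def using inv_into_f_f[OF inj, of i] that by simp
    have "F v - F u = (\<Sum>i=m..<n. \<Xi> (t i) (t (Suc i)))"
      using mn \<open>m \<le> n\<close> by (simp add: F lessThan_atLeast0 sum_diff_nat_ivl)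
    moreover have "\<bar>(\<Sum>i=m..<n. \<Xi> (t i) (t (Suc i))) - \<Xi> (t m) (t n)\<bar> \<le>
        sewing_constant * K * \<omega> (t m) (t n) powr \<theta>"
      using uv D mn \<open>m \<le> n\<close> mono
      by (intro sewing_maximal_inequality[OF \<Xi> K]) auto
    ultimately show "\<bar>F v - F u - \<Xi> u v\<bar> \<le> sewing_constant * K * \<omega> u v powr \<theta>"
      by (simp add: mn)
  qed
qed

text \<open>
  The constraints on \<open>F\<close> are closed conditions in the product topology, each involving two
  values of \<open>F\<close> only, and finitely many of them can be met.  The constraints for \<open>u = 0\<close> confine
  \<open>F t - F 0\<close> to a compact interval, so by Tychonoff's theorem all of them can be met.
\<close>

lemma sewing:
  fixes \<Xi> :: "real \<Rightarrow> real \<Rightarrow> real"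
  assumes \<Xi>: "\<And>u w v. 0 \<le> u \<Longrightarrow> u \<le> w \<Longrightarrow> w \<le> v \<Longrightarrow> v \<le> T \<Longrightarrow>
             \<bar>\<Xi> u v - \<Xi> u w - \<Xi> w v\<bar> \<le> K * \<omega> u v powr \<theta>"
    and K: "0 \<le> K"
  obtains F where "\<And>u v. 0 \<le> u \<Longrightarrow> u \<le> v \<Longrightarrow> v \<le> T \<Longrightarrow>
    \<bar>F v - F u - \<Xi> u v\<bar> \<le> sewing_constant * K * \<omega> u v powr \<theta>"
proof -
  define I where "I t = cball (\<Xi> 0 t) (sewing_constant * K * \<omega> 0 t powr \<theta>)" for t
  define S where "S = (\<lambda>(u, v). {F. \<bar>F v - F u - \<Xi> u v\<bar> \<le> sewing_constant * K * \<omega> u v powr \<theta>})"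
  define P where "P = {(u, v). 0 \<le> u \<and> u \<le> v \<and> v \<le> T}"
  have compact: "compact (Pi\<^sub>E UNIV I)"
    using compactin_PiE[of "\<lambda>_. euclidean" UNIV I]
    by (simp add: I_def euclidean_product_topology)
  have closed: "closed (S q)" for q
    unfolding S_def split_beta
    by (intro closed_Collect_le continuous_intros continuous_on_product_coordinates)
  have fip: "Pi\<^sub>E UNIV I \<inter> (\<Inter>q\<in>Q. S q) \<noteq> {}" if Q: "finite Q" "Q \<subseteq> P" for Q
  proof -
    let ?D = "insert 0 (fst ` Q \<union> snd ` Q)"
    have "finite ?D" "?D \<subseteq> {0..T}"
      using Q T_nonneg by (auto simp: P_def)
    then have "\<exists>F. \<forall>u\<in>?D. \<forall>v\<in>?D. u \<le> v \<longrightarrow>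
        \<bar>F v - F u - \<Xi> u v\<bar> \<le> sewing_constant * K * \<omega> u v powr \<theta>"
      by (intro sewing_on_finite_set \<Xi> K)
    then obtain F where F: "\<And>u v. u \<in> ?D \<Longrightarrow> v \<in> ?D \<Longrightarrow> u \<le> v \<Longrightarrow>
        \<bar>F v - F u - \<Xi> u v\<bar> \<le> sewing_constant * K * \<omega> u v powr \<theta>"
      by blast
    \<comment> \<open>Normalised at \<open>0\<close>; at the remaining points any value in the compact interval will do.\<close>
    define G where "G x = (if x \<in> ?D then F x - F 0 else \<Xi> 0 x)" for x
    have "G x \<in> I x" for x
    proof (cases "x \<in> ?D")
      case True
      then have "0 \<le> x" using \<open>?D \<subseteq> {0..T}\<close> by auto
      then have "\<bar>G x - \<Xi> 0 x\<bar> \<le> sewing_constant * K * \<omega> 0 x powr \<theta>"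
        using True F[of 0 x] unfolding G_def by simp
      then show ?thesis
        by (simp add: I_def dist_real_def abs_minus_commute)
    next
      case False
      then show ?thesis using K sewing_constant_pos by (auto simp: I_def G_def)
    qed
    moreover have "G \<in> S q" if "q \<in> Q" for q
    proof -
      have "fst q \<in> ?D" "snd q \<in> ?D" "fst q \<le> snd q"
        using that Q(2) by (auto simp: P_def)
      moreover from this have "\<bar>G (snd q) - G (fst q) - \<Xi> (fst q) (snd q)\<bar>
          \<le> sewing_constant * K * \<omega> (fst q) (snd q) powr \<theta>"
        using F[of "fst q" "snd q"] unfolding G_def by simp
      ultimately show ?thesis by (simp add: S_def split_beta)
    qed
    ultimately have "G \<in> Pi\<^sub>E UNIV I \<inter> (\<Inter>q\<in>Q. S q)" by auto
    then show ?thesis by blast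
  qed
  have "Pi\<^sub>E UNIV I \<inter> (\<Inter>q\<in>P. S q) \<noteq> {}"
    by (rule compact_imp_fip_image[OF compact closed fip])
  then obtain F where F: "\<And>q. q \<in> P \<Longrightarrow> F \<in> S q" by blast
  show ?thesis
  proof (rule that)
    fix u v :: real assume "0 \<le> u" "u \<le> v" "v \<le> T"
    then show "\<bar>F v - F u - \<Xi> u v\<bar> \<le> sewing_constant * K * \<omega> u v powr \<theta>"
      using F[of "(u, v)"] by (simp add: P_def S_def)
  qed
qed

end

section \<open>Calculus of Young primitives\<close>

text \<open>
  The last condition is what remains of the fact that the control of a continuous path is small on
  short intervals; it makes errors of order \<open>\<omega> u v powr \<theta>\<close> negligible in Riemann--Stieltjes sums.
\<close>

locale young_control = superadditive_control \<omega> T \<theta>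
  for \<omega> :: "real \<Rightarrow> real \<Rightarrow> real" and T \<theta> :: real +
  fixes \<gamma> :: "real \<Rightarrow> 'a::euclidean_space"
  assumes path_increment:
      "0 \<le> u \<Longrightarrow> u \<le> v \<Longrightarrow> v \<le> T \<Longrightarrow> norm (\<gamma> v - \<gamma> u) \<le> \<omega> u v powr (\<theta> / 2)"
    and mesh_sum:
      "0 < \<epsilon> \<Longrightarrow> \<exists>\<delta>>0. \<forall>t P. 0 \<le> t \<and> t \<le> T \<and> P tagged_division_of {0..t} \<and>
         (\<forall>(s, K)\<in>P. Sup K - Inf K < \<delta>) \<longrightarrow> (\<Sum>(s, K)\<in>P. \<omega> (Inf K) (Sup K) powr \<theta>) \<le> \<epsilon>"
begin

lemma powr_half_mult: "\<omega> u v powr (\<theta> / 2) * \<omega> u v powr (\<theta> / 2) = \<omega> u v powr \<theta>"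
  by (simp flip: powr_add)

lemma control_powr_mono:
  assumes "0 \<le> u" "u \<le> u'" "u' \<le> v'" "v' \<le> v" "v \<le> T" "0 \<le> e"
  shows "\<omega> u' v' powr e \<le> \<omega> u v powr e"
  using assms by (intro powr_mono2 control_nonneg control_mono) auto

text \<open>
  The constant is kept explicit because the convergence of the winding series rests on its decay.
\<close>

definition controlled :: "real \<Rightarrow> (real \<Rightarrow> 'b::real_normed_vector) \<Rightarrow> bool" where
  "controlled A f \<longleftrightarrow> 0 \<le> A \<and>
     (\<forall>u v. 0 \<le> u \<longrightarrow> u \<le> v \<longrightarrow> v \<le> T \<longrightarrow> norm (f v - f u) \<le> A * \<omega> u v powr (\<theta> / 2))"

lemma controlledI:
  assumes "0 \<le> A"
    and "\<And>u v. 0 \<le> u \<Longrightarrow> u \<le> v \<Longrightarrow> v \<le> T \<Longrightarrow> norm (f v - f u) \<le> A * \<omega> u v powr (\<theta> / 2)"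
  shows "controlled A f"
  using assms by (simp add: controlled_def)

lemma controlledD:
  assumes "controlled A f"
  shows "0 \<le> A"
    and "0 \<le> u \<Longrightarrow> u \<le> v \<Longrightarrow> v \<le> T \<Longrightarrow> norm (f v - f u) \<le> A * \<omega> u v powr (\<theta> / 2)"
  using assms by (simp_all add: controlled_def)

lemma controlledD_subinterval:
  assumes "controlled A f" "0 \<le> u" "u \<le> u'" "u' \<le> v'" "v' \<le> v" "v \<le> T"
  shows "norm (f v' - f u') \<le> A * \<omega> u v powr (\<theta> / 2)"
proof -
  have "norm (f v' - f u') \<le> A * \<omega> u' v' powr (\<theta> / 2)"
    using assms by (intro controlledD(2)) auto
  also have "\<dots> \<le> A * \<omega> u v powr (\<theta> / 2)"
    using assms \<theta>_gt_1 by (intro mult_left_mono control_powr_mono controlledD(1)[OF assms(1)]) auto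
  finally show ?thesis .
qed

lemma controlled_bounded:
  assumes "controlled A f" "0 \<le> t" "t \<le> T"
  shows "norm (f t) \<le> norm (f 0) + A * \<omega> 0 T powr (\<theta> / 2)"
  using controlledD_subinterval[OF assms(1), of 0 0 t T] assms norm_triangle_sub[of "f t" "f 0"]
  by linarith

lemma controlled_const: "controlled 0 (\<lambda>t. c)"
  by (simp add: controlled_def)

lemma controlled_add:
  assumes f: "controlled A f" and g: "controlled B g"
  shows "controlled (A + B) (\<lambda>t. f t + g t)"
proof (rule controlledI)
  show "0 \<le> A + B" using controlledD(1)[OF f] controlledD(1)[OF g] by simp
  fix u v assume uv: "0 \<le> u" "u \<le> v" "v \<le> T"
  have "norm ((f v + g v) - (f u + g u)) \<le> norm (f v - f u) + norm (g v - g u)"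
    by (metis add_diff_add norm_triangle_ineq)
  also have "\<dots> \<le> (A + B) * \<omega> u v powr (\<theta> / 2)"
    using controlledD(2)[OF f uv] controlledD(2)[OF g uv] by (simp add: distrib_right)
  finally show "norm ((f v + g v) - (f u + g u)) \<le> (A + B) * \<omega> u v powr (\<theta> / 2)" .
qed

lemma controlled_scaleR:
  assumes a: "controlled A a" and f: "controlled B f"
    and \<alpha>: "\<And>t. 0 \<le> t \<Longrightarrow> t \<le> T \<Longrightarrow> \<bar>a t\<bar> \<le> \<alpha>"
    and \<beta>: "\<And>t. 0 \<le> t \<Longrightarrow> t \<le> T \<Longrightarrow> norm (f t) \<le> \<beta>"
  shows "controlled (\<alpha> * B + \<beta> * A) (\<lambda>t. a t *\<^sub>R f t)"
proof (rule controlledI)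
  have \<alpha>0: "0 \<le> \<alpha>" and \<beta>0: "0 \<le> \<beta>"
    using \<alpha>[of 0] \<beta>[of 0] T_nonneg norm_ge_zero[of "f 0"] by linarith+
  then show "0 \<le> \<alpha> * B + \<beta> * A"
    using controlledD(1)[OF f] controlledD(1)[OF a] by simp
  fix u v assume uv: "0 \<le> u" "u \<le> v" "v \<le> T"
  have "a v *\<^sub>R f v - a u *\<^sub>R f u = a v *\<^sub>R (f v - f u) + (a v - a u) *\<^sub>R f u"
    by (simp add: algebra_simps)
  then have "norm (a v *\<^sub>R f v - a u *\<^sub>R f u) \<le> \<bar>a v\<bar> * norm (f v - f u) + \<bar>a v - a u\<bar> * norm (f u)"
    by (metis norm_scaleR norm_triangle_ineq)
  also have "\<dots> \<le> \<alpha> * (B * \<omega> u v powr (\<theta> / 2)) + (A * \<omega> u v powr (\<theta> / 2)) * \<beta>"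
    using uv controlledD(2)[OF f uv] controlledD(2)[OF a uv] \<alpha>[of v] \<beta>[of u] \<alpha>0 controlledD(1)[OF a]
    by (intro add_mono mult_mono) auto
  finally show "norm (a v *\<^sub>R f v - a u *\<^sub>R f u) \<le> (\<alpha> * B + \<beta> * A) * \<omega> u v powr (\<theta> / 2)"
    by (simp add: algebra_simps)
qed

lemma ex_controlled_scaleR:
  assumes "\<exists>A. controlled A a" "\<exists>B. controlled B f"
  shows "\<exists>C. controlled C (\<lambda>t. a t *\<^sub>R f t)"
proof -
  from assms obtain A B where a: "controlled A a" and f: "controlled B f" by blast
  show ?thesis
    using controlled_scaleR[OF a f] controlled_bounded[OF a] controlled_bounded[OF f]
    unfolding real_norm_def by blast
qed

lemma ex_controlled_add:
  "\<exists>A. controlled A f \<Longrightarrow> \<exists>B. controlled B g \<Longrightarrow> \<exists>C. controlled C (\<lambda>t. f t + g t)"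
  using controlled_add by blast

lemma ex_controlled_cmult:
  assumes "\<exists>A. controlled A f"
  shows "\<exists>C. controlled C (\<lambda>t. c *\<^sub>R f t)"
  using ex_controlled_scaleR[of "\<lambda>_. c" f] assms controlled_const by blast

lemma controlled_linear_form: "controlled (norm \<phi>) (\<lambda>t. blinfun_apply \<phi> (\<gamma> t))"
proof (rule controlledI)
  fix u v assume "0 \<le> u" "u \<le> v" "v \<le> T"
  then have "norm \<phi> * norm (\<gamma> v - \<gamma> u) \<le> norm \<phi> * \<omega> u v powr (\<theta> / 2)"
    by (intro mult_left_mono path_increment) auto
  then show "norm (blinfun_apply \<phi> (\<gamma> v) - blinfun_apply \<phi> (\<gamma> u)) \<le> norm \<phi> * \<omega> u v powr (\<theta> / 2)"
    using norm_blinfun[of \<phi> "\<gamma> v - \<gamma> u"] by (simp add: blinfun.diff_right)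
qed simp

text \<open>
  This is the relation \<open>dF = f d\<gamma>\<close>, with a second order error and with an arbitrary tag \<open>s\<close>, as in the
  sums that define the Young integral.
\<close>

definition young_primitive :: "(real \<Rightarrow> 'a \<Rightarrow>\<^sub>L real) \<Rightarrow> (real \<Rightarrow> real) \<Rightarrow> bool" where
  "young_primitive f F \<longleftrightarrow>
     (\<exists>K. \<forall>u s v. 0 \<le> u \<longrightarrow> u \<le> s \<longrightarrow> s \<le> v \<longrightarrow> v \<le> T \<longrightarrow>
        \<bar>F v - F u - blinfun_apply (f s) (\<gamma> v - \<gamma> u)\<bar> \<le> K * \<omega> u v powr \<theta>)"

lemma young_primitiveI:
  assumes "\<And>u s v. 0 \<le> u \<Longrightarrow> u \<le> s \<Longrightarrow> s \<le> v \<Longrightarrow> v \<le> T \<Longrightarrow>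
    \<bar>F v - F u - blinfun_apply (f s) (\<gamma> v - \<gamma> u)\<bar> \<le> K * \<omega> u v powr \<theta>"
  shows "young_primitive f F"
  using assms unfolding young_primitive_def by blast

lemma young_primitiveD:
  assumes "young_primitive f F"
  shows "\<exists>K\<ge>0. \<forall>u s v. 0 \<le> u \<longrightarrow> u \<le> s \<longrightarrow> s \<le> v \<longrightarrow> v \<le> T \<longrightarrow>
    \<bar>F v - F u - blinfun_apply (f s) (\<gamma> v - \<gamma> u)\<bar> \<le> K * \<omega> u v powr \<theta>"
proof -
  from assms obtain K where K: "\<And>u s v. 0 \<le> u \<Longrightarrow> u \<le> s \<Longrightarrow> s \<le> v \<Longrightarrow> v \<le> T \<Longrightarrow>
    \<bar>F v - F u - blinfun_apply (f s) (\<gamma> v - \<gamma> u)\<bar> \<le> K * \<omega> u v powr \<theta>"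
    unfolding young_primitive_def by blast
  have "K * \<omega> u v powr \<theta> \<le> \<bar>K\<bar> * \<omega> u v powr \<theta>" for u v
    by (intro mult_right_mono) auto
  with K show ?thesis
    by (intro exI[of _ "\<bar>K\<bar>"]) (meson abs_ge_zero order_trans)
qed

text \<open>
  For \<open>\<Xi> u v = f u (\<gamma> v - \<gamma> u)\<close> the failure of additivity at \<open>w\<close> is \<open>(f u - f w) (\<gamma> v - \<gamma> w)\<close>, a product of
  two increments, so the sewing lemma applies.
\<close>

lemma young_primitive_exists:
  assumes f: "controlled A f"
  obtains F where "young_primitive f F"
    and "\<bar>F T - F 0 - blinfun_apply (f 0) (\<gamma> T - \<gamma> 0)\<bar> \<le> sewing_constant * A * \<omega> 0 T powr \<theta>"
proof -
  \<comment> \<open>Moving the tag costs a product of two increments.\<close>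
  have incr: "\<bar>blinfun_apply (f s') (\<gamma> y - \<gamma> x) - blinfun_apply (f s) (\<gamma> y - \<gamma> x)\<bar> \<le> A * \<omega> u v powr \<theta>"
    if "0 \<le> u" "u \<le> s" "s \<le> s'" "s' \<le> v" "u \<le> x" "x \<le> y" "y \<le> v" "v \<le> T" for u v s s' x y
  proof -
    have "\<bar>blinfun_apply (f s') (\<gamma> y - \<gamma> x) - blinfun_apply (f s) (\<gamma> y - \<gamma> x)\<bar>
        \<le> norm (f s' - f s) * norm (\<gamma> y - \<gamma> x)"
      using norm_blinfun[of "f s' - f s" "\<gamma> y - \<gamma> x"] by (simp add: blinfun.diff_left)
    also have "\<dots> \<le> (A * \<omega> u v powr (\<theta> / 2)) * \<omega> u v powr (\<theta> / 2)"
    proof (intro mult_mono)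
      show "norm (f s' - f s) \<le> A * \<omega> u v powr (\<theta> / 2)"
        using that by (intro controlledD_subinterval[OF f]) auto
      have "norm (\<gamma> y - \<gamma> x) \<le> \<omega> x y powr (\<theta> / 2)" using that by (intro path_increment) auto
      also have "\<dots> \<le> \<omega> u v powr (\<theta> / 2)"
        using that \<theta>_gt_1 by (intro control_powr_mono) auto
      finally show "norm (\<gamma> y - \<gamma> x) \<le> \<omega> u v powr (\<theta> / 2)" .
    qed (use controlledD(1)[OF f] in auto)
    finally show ?thesis by (simp add: mult.assoc powr_half_mult)
  qed
  define \<Xi> where "\<Xi> u v = blinfun_apply (f u) (\<gamma> v - \<gamma> u)" for u v
  have "\<bar>\<Xi> u v - \<Xi> u w - \<Xi> w v\<bar> \<le> A * \<omega> u v powr \<theta>"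
    if "0 \<le> u" "u \<le> w" "w \<le> v" "v \<le> T" for u w v
  proof -
    have "\<Xi> u v - \<Xi> u w - \<Xi> w v = blinfun_apply (f u) (\<gamma> v - \<gamma> w) - blinfun_apply (f w) (\<gamma> v - \<gamma> w)"
      by (simp add: \<Xi>_def blinfun.diff_right)
    then show ?thesis using incr[of u u w v w v] that by (simp add: abs_minus_commute)
  qed
  then obtain F where F: "\<And>u v. 0 \<le> u \<Longrightarrow> u \<le> v \<Longrightarrow> v \<le> T \<Longrightarrow>
    \<bar>F v - F u - \<Xi> u v\<bar> \<le> sewing_constant * A * \<omega> u v powr \<theta>"
    using sewing controlledD(1)[OF f] by blast
  have "young_primitive f F"
  proof (rule young_primitiveI)
    fix u s v assume *: "0 \<le> u" "u \<le> s" "s \<le> v" "v \<le> T"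
    show "\<bar>F v - F u - blinfun_apply (f s) (\<gamma> v - \<gamma> u)\<bar> \<le> (sewing_constant * A + A) * \<omega> u v powr \<theta>"
      using F[of u v] incr[of u u s v u v] * unfolding \<Xi>_def distrib_right by force
  qed
  moreover have "\<bar>F T - F 0 - blinfun_apply (f 0) (\<gamma> T - \<gamma> 0)\<bar> \<le> sewing_constant * A * \<omega> 0 T powr \<theta>"
    using F[of 0 T] T_nonneg by (simp add: \<Xi>_def)
  ultimately show ?thesis by (rule that)
qed

text \<open>
  The increments of \<open>F\<close> over a tagged division telescope to \<open>F t - F 0\<close>, and the sum of the errors
  is controlled by the mesh condition.
\<close>

lemma young_primitive_imp_has_young_integral:
  assumes F: "young_primitive f F" and t: "0 \<le> t" "t \<le> T"
  shows "has_young_integral 0 t f \<gamma> (F t - F 0)"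
  unfolding has_young_integral_def
proof (intro allI impI)
  fix \<epsilon> :: real assume "0 < \<epsilon>"
  obtain K where K: "0 \<le> K" "\<And>u s v. 0 \<le> u \<Longrightarrow> u \<le> s \<Longrightarrow> s \<le> v \<Longrightarrow> v \<le> T \<Longrightarrow>
      \<bar>F v - F u - blinfun_apply (f s) (\<gamma> v - \<gamma> u)\<bar> \<le> K * \<omega> u v powr \<theta>"
    using young_primitiveD[OF F] by blast
  have "0 < \<epsilon> / (K + 1)" using \<open>0 < \<epsilon>\<close> K(1) by simp
  from mesh_sum[OF this] obtain \<delta> where \<delta>: "0 < \<delta>"
    "\<And>P. P tagged_division_of {0..t} \<Longrightarrow> \<forall>(s, K)\<in>P. Sup K - Inf K < \<delta> \<Longrightarrow>
      (\<Sum>(s, L)\<in>P. \<omega> (Inf L) (Sup L) powr \<theta>) \<le> \<epsilon> / (K + 1)"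
    using t by blast
  show "\<exists>\<delta>>0. \<forall>P. P tagged_division_of {0..t} \<and> (\<forall>(s, K)\<in>P. Sup K - Inf K < \<delta>) \<longrightarrow>
      \<bar>(\<Sum>(s, K)\<in>P. blinfun_apply (f s) (\<gamma> (Sup K) - \<gamma> (Inf K))) - (F t - F 0)\<bar> < \<epsilon>"
  proof (intro exI[of _ \<delta>] conjI allI impI; (elim conjE)?)
    fix P assume P: "P tagged_division_of {0..t}" and mesh: "\<forall>(s, K)\<in>P. Sup K - Inf K < \<delta>"
    have "(\<Sum>(s, L)\<in>P. blinfun_apply (f s) (\<gamma> (Sup L) - \<gamma> (Inf L))) - (F t - F 0) =
        (\<Sum>(s, L)\<in>P. blinfun_apply (f s) (\<gamma> (Sup L) - \<gamma> (Inf L)) - (F (Sup L) - F (Inf L)))"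
      by (simp add: additive_tagged_division_1[OF t(1) P, of F, symmetric] sum_subtractf split_beta)
    also have "\<bar>\<dots>\<bar> \<le> (\<Sum>(s, L)\<in>P. K * \<omega> (Inf L) (Sup L) powr \<theta>)"
    proof (rule order_trans[OF sum_abs sum_mono], clarify)
      fix s L assume sL: "(s, L) \<in> P"
      then obtain u v where L: "L = {u..v}"
        using tagged_division_ofD(4)[OF P] by (metis box_real(2))
      have "s \<in> L" "L \<subseteq> {0..t}" using tagged_division_ofD(2,3)[OF P sL] by auto
      then have "0 \<le> u" "u \<le> s" "s \<le> v" "v \<le> T" using L t by auto
      then show "\<bar>blinfun_apply (f s) (\<gamma> (Sup L) - \<gamma> (Inf L)) - (F (Sup L) - F (Inf L))\<bar>
          \<le> K * \<omega> (Inf L) (Sup L) powr \<theta>"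
        using K(2)[of u s v] L by (simp add: abs_minus_commute)
    qed
    also have "\<dots> = K * (\<Sum>(s, L)\<in>P. \<omega> (Inf L) (Sup L) powr \<theta>)"
      by (simp add: sum_distrib_left split_beta)
    also have "\<dots> \<le> K * (\<epsilon> / (K + 1))"
      using \<delta>(2)[OF P mesh] K(1) by (intro mult_left_mono)
    also have "\<dots> < \<epsilon>" using K(1) \<open>0 < \<epsilon>\<close> by (simp add: field_simps)
    finally show "\<bar>(\<Sum>(s, L)\<in>P. blinfun_apply (f s) (\<gamma> (Sup L) - \<gamma> (Inf L))) - (F t - F 0)\<bar> < \<epsilon>" .
  qed (fact \<delta>(1))
qed

lemma young_integral_eq:
  assumes "young_primitive f F" "0 \<le> t" "t \<le> T"
  shows "young_integral 0 t f \<gamma> = F t - F 0"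
  using assms young_primitive_imp_has_young_integral young_integral_eqI by blast

lemma young_primitive_cong:
  assumes "young_primitive f F"
    and "\<And>t. 0 \<le> t \<Longrightarrow> t \<le> T \<Longrightarrow> f t = g t" and "\<And>t. 0 \<le> t \<Longrightarrow> t \<le> T \<Longrightarrow> F t = G t"
  shows "young_primitive g G"
proof -
  obtain K where K: "0 \<le> K" "\<And>u s v. 0 \<le> u \<Longrightarrow> u \<le> s \<Longrightarrow> s \<le> v \<Longrightarrow> v \<le> T \<Longrightarrow>
      \<bar>F v - F u - blinfun_apply (f s) (\<gamma> v - \<gamma> u)\<bar> \<le> K * \<omega> u v powr \<theta>"
    using young_primitiveD[OF assms(1)] by blast
  show ?thesis
    using K(2) assms(2,3) by (intro young_primitiveI[where K = K]) simp
qed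

text \<open>
  The sewing lemma gives the bound for one primitive; all primitives have the same increments, these
  being Young integrals.
\<close>

lemma young_integral_estimate:
  assumes f: "controlled A f" and F: "young_primitive f F"
  shows "\<bar>F T - F 0 - blinfun_apply (f 0) (\<gamma> T - \<gamma> 0)\<bar> \<le> sewing_constant * A * \<omega> 0 T powr \<theta>"
proof -
  obtain G where G: "young_primitive f G"
    "\<bar>G T - G 0 - blinfun_apply (f 0) (\<gamma> T - \<gamma> 0)\<bar> \<le> sewing_constant * A * \<omega> 0 T powr \<theta>"
    using young_primitive_exists[OF f] .
  have "F T - F 0 = G T - G 0"
    using young_integral_eq[OF F, of T] young_integral_eq[OF G(1), of T] T_nonneg by simp
  with G(2) show ?thesis by simp
qed

text \<open>
  This allows integration to be iterated.
\<close>

lemma controlled_young_primitive: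
  assumes f: "controlled A f" and F: "young_primitive f F"
  shows "\<exists>B. controlled B F"
proof -
  obtain K where K: "0 \<le> K" "\<And>u s v. 0 \<le> u \<Longrightarrow> u \<le> s \<Longrightarrow> s \<le> v \<Longrightarrow> v \<le> T \<Longrightarrow>
      \<bar>F v - F u - blinfun_apply (f s) (\<gamma> v - \<gamma> u)\<bar> \<le> K * \<omega> u v powr \<theta>"
    using young_primitiveD[OF F] by blast
  define M where "M = norm (f 0) + A * \<omega> 0 T powr (\<theta> / 2)"
  have M: "0 \<le> M" using controlledD(1)[OF f] by (simp add: M_def)
  have "controlled (M + K * \<omega> 0 T powr (\<theta> / 2)) F"
  proof (rule controlledI)
    show "0 \<le> M + K * \<omega> 0 T powr (\<theta> / 2)" using M K(1) by simp
    fix u v assume uv: "0 \<le> u" "u \<le> v" "v \<le> T"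
    have "\<bar>blinfun_apply (f u) (\<gamma> v - \<gamma> u)\<bar> \<le> norm (f u) * norm (\<gamma> v - \<gamma> u)"
      using norm_blinfun[of "f u" "\<gamma> v - \<gamma> u"] by simp
    also have "\<dots> \<le> M * \<omega> u v powr (\<theta> / 2)"
      unfolding M_def using uv M[unfolded M_def]
      by (intro mult_mono controlled_bounded[OF f] path_increment) auto
    finally have 1: "\<bar>blinfun_apply (f u) (\<gamma> v - \<gamma> u)\<bar> \<le> M * \<omega> u v powr (\<theta> / 2)" .
    have "K * \<omega> u v powr \<theta> \<le> K * (\<omega> 0 T powr (\<theta> / 2) * \<omega> u v powr (\<theta> / 2))"
      unfolding powr_half_mult[symmetric] using uv \<theta>_gt_1 K(1)
      by (intro mult_left_mono mult_right_mono control_powr_mono) auto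
    then show "norm (F v - F u) \<le> (M + K * \<omega> 0 T powr (\<theta> / 2)) * \<omega> u v powr (\<theta> / 2)"
      using 1 K(2)[of u u v] uv by (simp add: distrib_right mult.assoc)
  qed
  then show ?thesis ..
qed

lemma young_primitive_zero: "young_primitive (\<lambda>s. 0) (\<lambda>t. c)"
  by (rule young_primitiveI[where K = 0]) simp

lemma young_primitive_add:
  assumes "young_primitive f F" "young_primitive g G"
  shows "young_primitive (\<lambda>s. f s + g s) (\<lambda>t. F t + G t)"
proof -
  obtain K where K: "0 \<le> K" "\<And>u s v. 0 \<le> u \<Longrightarrow> u \<le> s \<Longrightarrow> s \<le> v \<Longrightarrow> v \<le> T \<Longrightarrow>
      \<bar>F v - F u - blinfun_apply (f s) (\<gamma> v - \<gamma> u)\<bar> \<le> K * \<omega> u v powr \<theta>"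
    using young_primitiveD[OF assms(1)] by blast
  obtain L where L: "0 \<le> L" "\<And>u s v. 0 \<le> u \<Longrightarrow> u \<le> s \<Longrightarrow> s \<le> v \<Longrightarrow> v \<le> T \<Longrightarrow>
      \<bar>G v - G u - blinfun_apply (g s) (\<gamma> v - \<gamma> u)\<bar> \<le> L * \<omega> u v powr \<theta>"
    using young_primitiveD[OF assms(2)] by blast
  show ?thesis
  proof (rule young_primitiveI)
    fix u s v assume *: "0 \<le> u" "u \<le> s" "s \<le> v" "v \<le> T"
    show "\<bar>F v + G v - (F u + G u) - blinfun_apply (f s + g s) (\<gamma> v - \<gamma> u)\<bar> \<le> (K + L) * \<omega> u v powr \<theta>"
      using K(2)[OF *] L(2)[OF *] by (simp add: blinfun.add_left distrib_right)
  qed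
qed

lemma young_primitive_cmult:
  assumes "young_primitive f F"
  shows "young_primitive (\<lambda>s. c *\<^sub>R f s) (\<lambda>t. c * F t)"
proof -
  obtain K where K: "0 \<le> K" "\<And>u s v. 0 \<le> u \<Longrightarrow> u \<le> s \<Longrightarrow> s \<le> v \<Longrightarrow> v \<le> T \<Longrightarrow>
      \<bar>F v - F u - blinfun_apply (f s) (\<gamma> v - \<gamma> u)\<bar> \<le> K * \<omega> u v powr \<theta>"
    using young_primitiveD[OF assms(1)] by blast
  show ?thesis
  proof (rule young_primitiveI)
    fix u s v assume *: "0 \<le> u" "u \<le> s" "s \<le> v" "v \<le> T"
    have "c * F v - c * F u - blinfun_apply (c *\<^sub>R f s) (\<gamma> v - \<gamma> u) =
        c * (F v - F u - blinfun_apply (f s) (\<gamma> v - \<gamma> u))"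
      by (simp add: blinfun.scaleR_left algebra_simps)
    then show "\<bar>c * F v - c * F u - blinfun_apply (c *\<^sub>R f s) (\<gamma> v - \<gamma> u)\<bar> \<le> (\<bar>c\<bar> * K) * \<omega> u v powr \<theta>"
      using mult_left_mono[OF K(2)[OF *], of "\<bar>c\<bar>"] by (simp add: abs_mult mult.assoc)
  qed
qed

lemma young_primitive_diff:
  assumes "young_primitive f F" "young_primitive g G"
  shows "young_primitive (\<lambda>s. f s - g s) (\<lambda>t. F t - G t)"
  using young_primitive_add[OF assms(1) young_primitive_cmult[OF assms(2), of "-1"]] by simp

lemma young_primitive_sum:
  assumes "\<And>i. i \<in> I \<Longrightarrow> young_primitive (f i) (F i)"
  shows "young_primitive (\<lambda>s. \<Sum>i\<in>I. f i s) (\<lambda>t. \<Sum>i\<in>I. F i t)"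
  using assms
  by (induction I rule: infinite_finite_induct) (auto intro: young_primitive_zero young_primitive_add)

text \<open>
  The product rule holds without a correction term because a product of two increments is
  itself of the order of the admissible error.
\<close>

lemma young_primitive_mult:
  assumes F: "young_primitive f F" and G: "young_primitive g G"
    and cF: "\<exists>A. controlled A F" and cG: "\<exists>B. controlled B G"
  shows "young_primitive (\<lambda>s. F s *\<^sub>R g s + G s *\<^sub>R f s) (\<lambda>t. F t * G t)"
proof -
  obtain A where A: "controlled A F" using cF ..
  obtain B where B: "controlled B G" using cG ..
  obtain K where K: "0 \<le> K" "\<And>u s v. 0 \<le> u \<Longrightarrow> u \<le> s \<Longrightarrow> s \<le> v \<Longrightarrow> v \<le> T \<Longrightarrow>
      \<bar>F v - F u - blinfun_apply (f s) (\<gamma> v - \<gamma> u)\<bar> \<le> K * \<omega> u v powr \<theta>"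
    using young_primitiveD[OF F] by blast
  obtain L where L: "0 \<le> L" "\<And>u s v. 0 \<le> u \<Longrightarrow> u \<le> s \<Longrightarrow> s \<le> v \<Longrightarrow> v \<le> T \<Longrightarrow>
      \<bar>G v - G u - blinfun_apply (g s) (\<gamma> v - \<gamma> u)\<bar> \<le> L * \<omega> u v powr \<theta>"
    using young_primitiveD[OF G] by blast
  define M where "M = \<bar>F 0\<bar> + A * \<omega> 0 T powr (\<theta> / 2)"
  define N where "N = \<bar>G 0\<bar> + B * \<omega> 0 T powr (\<theta> / 2)"
  have M: "\<bar>F s\<bar> \<le> M" and N: "\<bar>G s\<bar> \<le> N" if "0 \<le> s" "s \<le> T" for s
    using controlled_bounded[OF A that] controlled_bounded[OF B that] by (simp_all add: M_def N_def)
  show ?thesis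
  proof (rule young_primitiveI)
    fix u s v assume *: "0 \<le> u" "u \<le> s" "s \<le> v" "v \<le> T"
    let ?x = "\<gamma> v - \<gamma> u"
    have "F v * G v - F u * G u - blinfun_apply (F s *\<^sub>R g s + G s *\<^sub>R f s) ?x =
        F s * (G v - G u - blinfun_apply (g s) ?x) + G s * (F v - F u - blinfun_apply (f s) ?x)
        + (F v - F s) * (G v - G u) - (G s - G u) * (F v - F u)"
      by (simp add: blinfun.add_left blinfun.scaleR_left algebra_simps)
    also have "\<bar>\<dots>\<bar> \<le> \<bar>F s\<bar> * \<bar>G v - G u - blinfun_apply (g s) ?x\<bar>
        + \<bar>G s\<bar> * \<bar>F v - F u - blinfun_apply (f s) ?x\<bar>
        + \<bar>F v - F s\<bar> * \<bar>G v - G u\<bar> + \<bar>G s - G u\<bar> * \<bar>F v - F u\<bar>"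
      unfolding abs_mult[symmetric] by linarith
    also have "\<dots> \<le> M * (L * \<omega> u v powr \<theta>) + N * (K * \<omega> u v powr \<theta>)
        + (A * \<omega> u v powr (\<theta> / 2)) * (B * \<omega> u v powr (\<theta> / 2))
        + (B * \<omega> u v powr (\<theta> / 2)) * (A * \<omega> u v powr (\<theta> / 2))"
    proof (intro add_mono mult_mono M N K(2) L(2))
      note AA = controlledD_subinterval[OF A, unfolded real_norm_def]
      note BB = controlledD_subinterval[OF B, unfolded real_norm_def]
      show "\<bar>F v - F s\<bar> \<le> A * \<omega> u v powr (\<theta> / 2)" using * by (intro AA) auto
      show "\<bar>F v - F u\<bar> \<le> A * \<omega> u v powr (\<theta> / 2)" using * by (intro AA) auto
      show "\<bar>G v - G u\<bar> \<le> B * \<omega> u v powr (\<theta> / 2)" using * by (intro BB) auto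
      show "\<bar>G s - G u\<bar> \<le> B * \<omega> u v powr (\<theta> / 2)" using * by (intro BB) auto
      show "0 \<le> M" "0 \<le> N" using M[of s] N[of s] * by linarith+
    qed (use * controlledD(1)[OF A] controlledD(1)[OF B] in auto)
    also have "\<dots> = (M * L + N * K + 2 * A * B) * \<omega> u v powr \<theta>"
      unfolding powr_half_mult[symmetric] by (simp add: algebra_simps)
    finally show "\<bar>F v * G v - F u * G u - blinfun_apply (F s *\<^sub>R g s + G s *\<^sub>R f s) ?x\<bar>
        \<le> (M * L + N * K + 2 * A * B) * \<omega> u v powr \<theta>" .
  qed
qed

end

section \<open>A control from finite variation\<close>

text \<open>
  Take for \<open>h t\<close> the \<open>p\<close>-variation over \<open>{0..t}\<close>: a division of \<open>{0..u}\<close> and the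
  interval \<open>{u..v}\<close> together form a division of \<open>{0..v}\<close>.
\<close>

lemma p_variation_dominated_by_increments:
  fixes \<gamma> :: "real \<Rightarrow> 'a::euclidean_space"
  assumes "finite_p_variation p T \<gamma>"
  obtains h :: "real \<Rightarrow> real" where
    "\<And>u v. 0 \<le> u \<Longrightarrow> u \<le> v \<Longrightarrow> v \<le> T \<Longrightarrow> norm (\<gamma> v - \<gamma> u) powr p \<le> h v - h u"
proof -
  define S where "S \<D> = (\<Sum>K\<in>\<D>. norm (\<gamma> (Sup K) - \<gamma> (Inf K)) powr p)" for \<D>
  from assms obtain C where C: "\<And>\<D>. \<D> division_of {0..T} \<Longrightarrow> S \<D> \<le> C"
    unfolding finite_p_variation_def S_def by blast
  have extend: "insert {u..v} \<D> division_of {0..v}"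
    "S (insert {u..v} \<D>) = S \<D> + norm (\<gamma> v - \<gamma> u) powr p"
    if \<D>: "\<D> division_of {0..u}" and uv: "0 \<le> u" "u \<le> v" for u v \<D>
  proof -
    have "{{u..v}} division_of {u..v}"
      using division_of_self[of u v] uv by simp
    moreover have "interior {0..u} \<inter> interior {u..v} = {}" by auto
    moreover have "{0..u} \<union> {u..v} = {0..v}" using uv by auto
    ultimately show "insert {u..v} \<D> division_of {0..v}"
      using division_disjoint_union[OF \<D>, of "{{u..v}}" "{u..v}"] by simp
    show "S (insert {u..v} \<D>) = S \<D> + norm (\<gamma> v - \<gamma> u) powr p"
    \<comment> \<open>Divisions may contain degenerate intervals, so \<open>{u..v}\<close> may be present already if \<open>u = v\<close>.\<close>
    proof (cases "{u..v} \<in> \<D>")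
      case True
      then have "{u..v} \<subseteq> {0..u}" using division_ofD(2)[OF \<D>] by blast
      then have "v = u" using uv by auto
      then show ?thesis using True by (simp add: insert_absorb)
    next
      case False
      then show ?thesis
        using division_ofD(1)[OF \<D>] uv by (simp add: S_def)
    qed
  qed
  define h where "h t = Sup (S ` {\<D>. \<D> division_of {0..t}})" for t
  have bdd: "bdd_above (S ` {\<D>. \<D> division_of {0..t}})" if "0 \<le> t" "t \<le> T" for t
  proof (rule bdd_aboveI2)
    fix \<D> assume "\<D> \<in> {\<D>. \<D> division_of {0..t}}"
    then have "\<D> division_of {0..t}" by simp
    from C[OF extend(1)[OF this that]] extend(2)[OF this that]
    have "S \<D> + norm (\<gamma> T - \<gamma> t) powr p \<le> C" by simp
    then show "S \<D> \<le> C" by (smt (verit) powr_ge_zero)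
  qed
  show ?thesis
  proof (rule that)
    fix u v assume uv: "0 \<le> u" "u \<le> v" "v \<le> T"
    have "h u \<le> h v - norm (\<gamma> v - \<gamma> u) powr p"
      unfolding h_def[of u]
    proof (rule cSup_least)
      show "S ` {\<D>. \<D> division_of {0..u}} \<noteq> {}"
        using division_of_self[of 0 u] uv by auto
      fix x assume "x \<in> S ` {\<D>. \<D> division_of {0..u}}"
      then obtain \<D> where \<D>: "\<D> division_of {0..u}" "x = S \<D>" by auto
      have "S (insert {u..v} \<D>) \<le> h v"
        unfolding h_def using uv extend(1)[OF \<D>(1) uv(1,2)] by (intro cSup_upper bdd) auto
      then show "x \<le> h v - norm (\<gamma> v - \<gamma> u) powr p"
        using extend(2)[OF \<D>(1) uv(1,2)] \<D>(2) by simp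
    qed
    then show "norm (\<gamma> v - \<gamma> u) powr p \<le> h v - h u" by simp
  qed
qed

text \<open>
  The increments of the variation function \<open>h\<close> form a superadditive control for the exponent
  \<open>p\<close>, but monotonicity of \<open>h\<close> does not make them small on short intervals.  The continuity of \<open>\<gamma>\<close>
  does, once the exponent is raised to some \<open>q < 2\<close>: the surplus power \<open>q - p\<close> of an increment of \<open>\<gamma>\<close> is bounded by a modulus of
  continuity \<open>m (v - u)\<close>, and \<open>m (v - u) * (h v - h u)\<close> is superadditive, dominates the \<open>q\<close>-th power of
  the increment, and is small compared with \<open>h v - h u\<close> on short intervals.
\<close>

lemma ex_young_control:
  fixes \<gamma> :: "real \<Rightarrow> 'a::euclidean_space"
  assumes T: "0 \<le> T" and p: "1 \<le> p" "p < 2"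
    and cont: "continuous_on {0..T} \<gamma>" and var: "finite_p_variation p T \<gamma>"
  obtains \<omega> \<theta> where "young_control \<omega> T \<theta> \<gamma>"
proof -
  obtain h :: "real \<Rightarrow> real" where h:
    "\<And>u v. 0 \<le> u \<Longrightarrow> u \<le> v \<Longrightarrow> v \<le> T \<Longrightarrow> norm (\<gamma> v - \<gamma> u) powr p \<le> h v - h u"
    using p_variation_dominated_by_increments[OF var] by blast
  have h_mono: "h u \<le> h v" if "0 \<le> u" "u \<le> v" "v \<le> T" for u v
    using h[OF that] powr_ge_zero[of "norm (\<gamma> v - \<gamma> u)" p] by linarith
  \<comment> \<open>Any exponent strictly between \<open>p\<close> and \<open>2\<close> would do.\<close>
  define q where "q = (p + 2) / 2"
  define \<theta> where "\<theta> = 2 / q"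
  have q: "p < q" "1 < q" "q < 2" using p by (simp_all add: q_def)
  then have \<theta>: "1 < \<theta>" "\<theta> / 2 = 1 / q" by (simp_all add: \<theta>_def)
  define X where "X d = {norm (\<gamma> t - \<gamma> s) powr (q - p) | s t. 0 \<le> s \<and> s \<le> t \<and> t \<le> T \<and> t - s \<le> d}" for d
  define m where "m d = Sup (X d)" for d
  have "compact (\<gamma> ` {0..T})" using cont by (intro compact_continuous_image) auto
  then obtain B where B: "\<And>t. 0 \<le> t \<Longrightarrow> t \<le> T \<Longrightarrow> norm (\<gamma> t) \<le> B"
    unfolding bounded_iff using compact_imp_bounded bounded_iff by (metis atLeastAtMost_iff imageI)
  have bdd: "bdd_above (X d)" for d
  proof (rule bdd_aboveI)
    fix x assume "x \<in> X d"
    then obtain s t where st: "x = norm (\<gamma> t - \<gamma> s) powr (q - p)" "0 \<le> s" "s \<le> t" "t \<le> T"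
      by (auto simp: X_def)
    have "norm (\<gamma> t - \<gamma> s) \<le> 2 * B"
      using B[of s] B[of t] st norm_triangle_ineq4[of "\<gamma> t" "\<gamma> s"] by linarith
    then show "x \<le> (2 * B) powr (q - p)"
      unfolding st(1) using q by (intro powr_mono2) auto
  qed
  have zero: "0 \<in> X d" if "0 \<le> d" for d
    unfolding X_def using T that by (auto intro!: exI[of _ "0::real"])
  have m_ge: "norm (\<gamma> t - \<gamma> s) powr (q - p) \<le> m d" if "0 \<le> s" "s \<le> t" "t \<le> T" "t - s \<le> d" for s t d
    unfolding m_def using that by (intro cSup_upper bdd) (auto simp: X_def)
  have m_nonneg: "0 \<le> m d" if "0 \<le> d" for d
    unfolding m_def using that by (intro cSup_upper bdd zero)
  have m_mono: "m d \<le> m d'" if "0 \<le> d" "d \<le> d'" for d d'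
    unfolding m_def using that zero[of d]
    by (intro cSup_subset_mono bdd) (auto simp: X_def intro: order_trans)
  have m_small: "\<exists>\<delta>>0. \<forall>d. 0 \<le> d \<and> d < \<delta> \<longrightarrow> m d \<le> \<eta>" if "0 < \<eta>" for \<eta>
  proof -
    define e where "e = \<eta> powr (1 / (q - p))"
    have e: "0 < e" "e powr (q - p) = \<eta>" using that q by (simp_all add: e_def powr_powr)
    have "uniformly_continuous_on {0..T} \<gamma>"
      using cont by (intro compact_uniformly_continuous) auto
    then obtain \<delta> where \<delta>: "0 < \<delta>"
      "\<And>s t. s \<in> {0..T} \<Longrightarrow> t \<in> {0..T} \<Longrightarrow> dist t s < \<delta> \<Longrightarrow> dist (\<gamma> t) (\<gamma> s) < e"
      using e(1) unfolding uniformly_continuous_on_def by meson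
    have "m d \<le> \<eta>" if d: "0 \<le> d" "d < \<delta>" for d
      unfolding m_def
    proof (rule cSup_least)
      show "X d \<noteq> {}" using zero[OF d(1)] by auto
      fix x assume "x \<in> X d"
      then obtain s t where st: "x = norm (\<gamma> t - \<gamma> s) powr (q - p)" "0 \<le> s" "s \<le> t" "t \<le> T" "t - s \<le> d"
        by (auto simp: X_def)
      then have "norm (\<gamma> t - \<gamma> s) < e"
        using \<delta>(2)[of s t] d by (simp add: dist_norm)
      then show "x \<le> \<eta>"
        unfolding st(1) e(2)[symmetric] using q by (intro powr_mono2) auto
    qed
    with \<delta>(1) show ?thesis by blast
  qed
  define \<omega> where "\<omega> u v = m (v - u) * (h v - h u)" for u v
  have \<omega>_nonneg: "0 \<le> \<omega> u v" if "0 \<le> u" "u \<le> v" "v \<le> T" for u v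
    unfolding \<omega>_def using that h_mono[OF that] m_nonneg by simp
  have \<omega>_superadditive: "\<omega> u w + \<omega> w v \<le> \<omega> u v" if "0 \<le> u" "u \<le> w" "w \<le> v" "v \<le> T" for u w v
  proof -
    have "\<omega> u w \<le> m (v - u) * (h w - h u)" "\<omega> w v \<le> m (v - u) * (h v - h w)"
      unfolding \<omega>_def using that h_mono by (auto intro!: mult_right_mono m_mono)
    then show ?thesis unfolding \<omega>_def by (simp add: algebra_simps)
  qed
  interpret superadditive_control \<omega> T \<theta>
    using T \<theta>(1) \<omega>_nonneg \<omega>_superadditive by unfold_locales
  show ?thesis
  proof (rule that, unfold_locales)
    fix u v assume uv: "0 \<le> u" "u \<le> v" "v \<le> T"
    have "norm (\<gamma> v - \<gamma> u) powr q = norm (\<gamma> v - \<gamma> u) powr (q - p) * norm (\<gamma> v - \<gamma> u) powr p"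
      by (simp flip: powr_add)
    also have "\<dots> \<le> \<omega> u v"
      unfolding \<omega>_def using uv by (intro mult_mono m_ge h m_nonneg) auto
    finally have "(norm (\<gamma> v - \<gamma> u) powr q) powr (1 / q) \<le> \<omega> u v powr (1 / q)"
      using q by (intro powr_mono2) auto
    then show "norm (\<gamma> v - \<gamma> u) \<le> \<omega> u v powr (\<theta> / 2)"
      using q by (simp add: powr_powr \<theta>(2))
  next
    fix \<epsilon> :: real assume "0 < \<epsilon>"
    define H where "H = h T - h 0"
    define \<Omega> where "\<Omega> = \<omega> 0 T powr (\<theta> - 1)"
    have H: "0 \<le> H" using h_mono[of 0 T] T by (simp add: H_def)
    have \<Omega>: "0 \<le> \<Omega>" by (simp add: \<Omega>_def)
    define \<eta> where "\<eta> = \<epsilon> / (\<Omega> * H + 1)"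
    have \<eta>: "0 < \<eta>" using \<open>0 < \<epsilon>\<close> H \<Omega> by (simp add: \<eta>_def add_nonneg_pos)
    have \<eta>_bound: "\<Omega> * \<eta> * H \<le> \<epsilon>"
    proof -
      have pos: "0 < \<Omega> * H + 1" using H \<Omega> by (simp add: add_nonneg_pos)
      have "\<Omega> * \<eta> * H = \<epsilon> * (\<Omega> * H / (\<Omega> * H + 1))" by (simp add: \<eta>_def)
      also have "\<dots> \<le> \<epsilon> * 1"
        using pos \<open>0 < \<epsilon>\<close> by (intro mult_left_mono) (auto simp: divide_le_eq)
      finally show ?thesis by simp
    qed
    obtain \<delta> where \<delta>: "0 < \<delta>" "\<And>d. 0 \<le> d \<Longrightarrow> d < \<delta> \<Longrightarrow> m d \<le> \<eta>"
      using m_small[OF \<eta>] by blast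
    show "\<exists>\<delta>>0. \<forall>t P. 0 \<le> t \<and> t \<le> T \<and> P tagged_division_of {0..t} \<and>
         (\<forall>(s, K)\<in>P. Sup K - Inf K < \<delta>) \<longrightarrow> (\<Sum>(s, K)\<in>P. \<omega> (Inf K) (Sup K) powr \<theta>) \<le> \<epsilon>"
    proof (intro exI[of _ \<delta>] conjI allI impI; (elim conjE)?)
      fix t P assume t: "0 \<le> t" "t \<le> T" and P: "P tagged_division_of {0..t}"
        and mesh: "\<forall>(s, K)\<in>P. Sup K - Inf K < \<delta>"
      have "(\<Sum>(s, K)\<in>P. \<omega> (Inf K) (Sup K) powr \<theta>) \<le> (\<Sum>(s, K)\<in>P. \<Omega> * \<eta> * (h (Sup K) - h (Inf K)))"
      proof (rule sum_mono, clarify)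
        fix s K assume sK: "(s, K) \<in> P"
        then obtain u v where K: "K = {u..v}"
          using tagged_division_ofD(4)[OF P] by (metis box_real(2))
        have "s \<in> K" "K \<subseteq> {0..t}" using tagged_division_ofD(2,3)[OF P sK] by auto
        then have uv: "0 \<le> u" "u \<le> v" "v \<le> T" using K t by auto
        have small: "v - u < \<delta>" using mesh sK K uv by auto
        have "\<omega> u v powr \<theta> = \<omega> u v powr (\<theta> - 1) * \<omega> u v"
          using control_nonneg[OF uv] powr_add[of "\<omega> u v" "\<theta> - 1" 1] by (simp add: powr_one)
        also have "\<dots> \<le> \<Omega> * (\<eta> * (h v - h u))"
        proof (intro mult_mono)
          show "\<omega> u v powr (\<theta> - 1) \<le> \<Omega>"
            unfolding \<Omega>_def using uv \<theta>(1) by (intro powr_mono2 control_nonneg control_mono) auto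
          show "\<omega> u v \<le> \<eta> * (h v - h u)"
            unfolding \<omega>_def using uv small \<delta>(2)[of "v - u"] h_mono[OF uv] by (intro mult_right_mono) auto
        qed (use \<Omega> control_nonneg[OF uv] in auto)
        finally show "\<omega> (Inf K) (Sup K) powr \<theta> \<le> \<Omega> * \<eta> * (h (Sup K) - h (Inf K))"
          using K uv by (simp add: mult.assoc)
      qed
      also have "\<dots> = \<Omega> * \<eta> * (\<Sum>(s, K)\<in>P. h (Sup K) - h (Inf K))"
        by (simp add: sum_distrib_left split_beta)
      also have "\<dots> = \<Omega> * \<eta> * (h t - h 0)"
        by (simp add: additive_tagged_division_1[OF t(1) P])
      also have "\<dots> \<le> \<Omega> * \<eta> * H"
        unfolding H_def using t h_mono[of t T] \<Omega> \<eta> by (intro mult_left_mono) auto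
      finally show "(\<Sum>(s, K)\<in>P. \<omega> (Inf K) (Sup K) powr \<theta>) \<le> \<epsilon>"
        using \<eta>_bound by linarith
    qed (fact \<delta>(1))
  qed
qed

section \<open>Products of increments as functionals of the signature\<close>

context young_control
begin


text \<open>
  The three claims go together: an iterated integral can be integrated once more because it is
  controlled, and it is controlled because it is a primitive.  In particular all coordinates of the
  signature are genuine Young integrals, not the default value of a description operator.
\<close>

lemma iterated_integral_controlled_and_primitive:
  shows "\<exists>A. controlled A (iterated_integral \<gamma> w)"
    and "young_primitive (\<lambda>s. iterated_integral \<gamma> w s *\<^sub>R blinfun_inner_left b) (iterated_integral \<gamma> (b # w))"
    and "iterated_integral \<gamma> (b # w) 0 = 0"
proof -
  have step: "young_primitive (\<lambda>s. iterated_integral \<gamma> w s *\<^sub>R blinfun_inner_left b) (iterated_integral \<gamma> (b # w)) \<and>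
      iterated_integral \<gamma> (b # w) 0 = 0 \<and> (\<exists>B. controlled B (iterated_integral \<gamma> (b # w)))"
    if "\<exists>A. controlled A (iterated_integral \<gamma> w)" for w b
  proof -
    let ?f = "\<lambda>s. iterated_integral \<gamma> w s *\<^sub>R (blinfun_inner_left b :: 'a \<Rightarrow>\<^sub>L real)"
    have "\<exists>B. controlled B ?f"
      using that controlled_const by (intro ex_controlled_scaleR) auto
    then obtain B where B: "controlled B ?f" ..
    obtain F where F: "young_primitive ?f F" using young_primitive_exists[OF B] by blast
    have eq: "iterated_integral \<gamma> (b # w) t = F t - F 0" if "0 \<le> t" "t \<le> T" for t
      using young_integral_eq[OF F that] by simp
    have "young_primitive ?f (\<lambda>t. F t - F 0)"
      using young_primitive_diff[OF F young_primitive_zero[of "F 0"]] by simp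
    then have *: "young_primitive ?f (iterated_integral \<gamma> (b # w))"
      by (rule young_primitive_cong) (simp_all add: eq del: iterated_integral.simps)
    with eq[of 0] T_nonneg controlled_young_primitive[OF B *] show ?thesis by auto
  qed
  have ctl: "\<exists>A. controlled A (iterated_integral \<gamma> w)" for w
  proof (induction w)
    case Nil
    then show ?case using controlled_const[of 1] by auto
  next
    case (Cons b w)
    then show ?case using step by blast
  qed
  show "\<exists>A. controlled A (iterated_integral \<gamma> w)" by (rule ctl)
  show "young_primitive (\<lambda>s. iterated_integral \<gamma> w s *\<^sub>R blinfun_inner_left b) (iterated_integral \<gamma> (b # w))"
    "iterated_integral \<gamma> (b # w) 0 = 0"
    using step[OF ctl] by auto
qed

definition signature_form :: "('a \<Rightarrow>\<^sub>L real) list \<Rightarrow> real \<Rightarrow> real" where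
  "signature_form \<phi>s t = pairing (dual_tensor \<phi>s) (signature t \<gamma>)"

lemma signature_form_Nil: "signature_form [] t = 1"
proof -
  have "{w. set w \<subseteq> Basis \<and> length w = length []} = {[] :: 'a list}" by auto
  then show ?thesis by (simp add: signature_form_def pairing_dual_tensor signature_def)
qed

lemma words_snoc:
  "{w. set w \<subseteq> B \<and> length w = Suc n} = (\<lambda>(w, b). w @ [b]) ` ({w. set w \<subseteq> B \<and> length w = n} \<times> B)"
proof (intro equalityI subsetI)
  fix w assume "w \<in> {w. set w \<subseteq> B \<and> length w = Suc n}"
  then have w: "set w \<subseteq> B" "length w = Suc n" by auto
  then have "w = butlast w @ [last w]" by (metis append_butlast_last_id list.size(3) nat.distinct(1))
  moreover have "(butlast w, last w) \<in> {w. set w \<subseteq> B \<and> length w = n} \<times> B"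
    using w in_set_butlastD[of _ w] last_in_set[of w] by fastforce
  ultimately show "w \<in> (\<lambda>(w, b). w @ [b]) ` ({w. set w \<subseteq> B \<and> length w = n} \<times> B)"
    by (metis (no_types, lifting) case_prod_conv rev_image_eqI)
qed auto

lemma signature_form_snoc:
  "signature_form (\<phi>s @ [\<phi>]) t =
     (\<Sum>w | set w \<subseteq> Basis \<and> length w = length \<phi>s. \<Sum>b\<in>Basis.
        ((\<Prod>i<length \<phi>s. blinfun_apply (\<phi>s ! i) (w ! i)) * blinfun_apply \<phi> b) *
        iterated_integral \<gamma> (b # rev w) t)"
proof -
  let ?W = "{w. set w \<subseteq> (Basis :: 'a set) \<and> length w = length \<phi>s}"
  have inj: "inj_on (\<lambda>(w, b). w @ [b]) (?W \<times> (Basis :: 'a set))" by (auto simp: inj_on_def)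
  have "signature_form (\<phi>s @ [\<phi>]) t = (\<Sum>(w, b)\<in>?W \<times> Basis.
      ((\<Prod>i<length \<phi>s. blinfun_apply (\<phi>s ! i) (w ! i)) * blinfun_apply \<phi> b) *
        iterated_integral \<gamma> (b # rev w) t)"
    unfolding signature_form_def pairing_dual_tensor length_append_singleton words_snoc
      sum.reindex[OF inj]
    by (intro sum.cong refl) (auto simp: signature_def nth_append simp del: iterated_integral.simps)
  then show ?thesis by (simp add: sum.cartesian_product del: iterated_integral.simps)
qed

lemma signature_form_snoc_zero: "signature_form (\<phi>s @ [\<phi>]) 0 = 0"
  unfolding signature_form_snoc iterated_integral_controlled_and_primitive(3) by simp

text \<open>
  The last letter of a word is integrated last.  The pairing sums over the basis words, which
  amounts to expanding \<open>\<phi>\<close> in the dual basis.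
\<close>

lemma signature_form_snoc_primitive:
  "young_primitive (\<lambda>s. signature_form \<phi>s s *\<^sub>R \<phi>) (signature_form (\<phi>s @ [\<phi>]))"
proof -
  let ?W = "{w. set w \<subseteq> (Basis :: 'a set) \<and> length w = length \<phi>s}"
  let ?c = "\<lambda>w. (\<Prod>i<length \<phi>s. blinfun_apply (\<phi>s ! i) (w ! i))"
  have \<phi>: "\<phi> = (\<Sum>b\<in>Basis. blinfun_apply \<phi> b *\<^sub>R blinfun_inner_left b)"
  proof (rule blinfun_eqI)
    fix v
    have "blinfun_apply \<phi> v = blinfun_apply \<phi> (\<Sum>b\<in>Basis. (v \<bullet> b) *\<^sub>R b)"
      by (simp add: euclidean_representation)
    then show "blinfun_apply \<phi> v = blinfun_apply (\<Sum>b\<in>Basis. blinfun_apply \<phi> b *\<^sub>R blinfun_inner_left b) v"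
      by (simp add: blinfun.sum_right blinfun.scaleR_right blinfun.sum_left blinfun.scaleR_left mult.commute)
  qed
  have "young_primitive
      (\<lambda>s. \<Sum>w\<in>?W. \<Sum>b\<in>Basis. (?c w * blinfun_apply \<phi> b) *\<^sub>R (iterated_integral \<gamma> (rev w) s *\<^sub>R blinfun_inner_left b))
      (signature_form (\<phi>s @ [\<phi>]))"
    unfolding signature_form_snoc
    by (intro young_primitive_sum young_primitive_cmult iterated_integral_controlled_and_primitive(2))
  moreover have "(\<Sum>w\<in>?W. \<Sum>b\<in>Basis. (?c w * blinfun_apply \<phi> b) *\<^sub>R (iterated_integral \<gamma> (rev w) s *\<^sub>R blinfun_inner_left b))
      = signature_form \<phi>s s *\<^sub>R \<phi>" for s
  proof -
    have "(\<Sum>w\<in>?W. \<Sum>b\<in>Basis. (?c w * blinfun_apply \<phi> b) *\<^sub>R (iterated_integral \<gamma> (rev w) s *\<^sub>R blinfun_inner_left b))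
        = (\<Sum>w\<in>?W. (?c w * iterated_integral \<gamma> (rev w) s) *\<^sub>R (\<Sum>b\<in>Basis. blinfun_apply \<phi> b *\<^sub>R blinfun_inner_left b))"
      by (simp add: scaleR_sum_right mult_ac)
    also have "\<dots> = (\<Sum>w\<in>?W. (?c w * iterated_integral \<gamma> (rev w) s) *\<^sub>R \<phi>)"
      by (simp only: \<phi>[symmetric])
    also have "\<dots> = signature_form \<phi>s s *\<^sub>R \<phi>"
      by (simp add: scaleR_sum_left signature_form_def pairing_dual_tensor signature_def)
    finally show ?thesis .
  qed
  ultimately show ?thesis by simp
qed

definition increment_form :: "('a \<Rightarrow>\<^sub>L real) \<Rightarrow> real \<Rightarrow> real" where
  "increment_form \<phi> t = blinfun_apply \<phi> (\<gamma> t - \<gamma> 0)"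

lemma increment_form_primitive: "young_primitive (\<lambda>s. \<phi>) (increment_form \<phi>)"
  by (rule young_primitiveI[where K = 0]) (simp add: increment_form_def blinfun.diff_right)

lemma increment_form_controlled: "controlled (norm \<phi>) (increment_form \<phi>)"
  using controlled_linear_form[of \<phi>] unfolding controlled_def increment_form_def
  by (simp add: blinfun.diff_right)

lemma ex_controlled_prod:
  fixes F :: "'i \<Rightarrow> real \<Rightarrow> real"
  assumes "\<And>i. i \<in> I \<Longrightarrow> \<exists>A. controlled A (F i)"
  shows "\<exists>A. controlled A (\<lambda>t. \<Prod>i\<in>I. F i t)"
  using assms
proof (induction I rule: infinite_finite_induct)
  case (insert i I)
  then show ?case using ex_controlled_scaleR[of "F i" "\<lambda>t. \<Prod>i\<in>I. F i t"] by simp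
qed (use controlled_const in auto)

lemma young_primitive_prod:
  fixes F :: "'i \<Rightarrow> real \<Rightarrow> real"
  assumes "finite I"
    and "\<And>i. i \<in> I \<Longrightarrow> young_primitive (f i) (F i)"
    and "\<And>i. i \<in> I \<Longrightarrow> \<exists>A. controlled A (F i)"
  shows "young_primitive (\<lambda>s. \<Sum>i\<in>I. (\<Prod>j\<in>I - {i}. F j s) *\<^sub>R f i s) (\<lambda>t. \<Prod>i\<in>I. F i t)"
  using assms
proof (induction I rule: finite_induct)
  case empty
  show ?case using young_primitive_zero by simp
next
  case (insert k I)
  have "young_primitive (\<lambda>s. F k s *\<^sub>R (\<Sum>i\<in>I. (\<Prod>j\<in>I - {i}. F j s) *\<^sub>R f i s) + (\<Prod>i\<in>I. F i s) *\<^sub>R f k s)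
      (\<lambda>t. F k t * (\<Prod>i\<in>I. F i t))"
    using insert by (intro young_primitive_mult ex_controlled_prod) auto
  moreover have "F k s *\<^sub>R (\<Sum>i\<in>I. (\<Prod>j\<in>I - {i}. F j s) *\<^sub>R f i s) + (\<Prod>i\<in>I. F i s) *\<^sub>R f k s
      = (\<Sum>i\<in>insert k I. (\<Prod>j\<in>insert k I - {i}. F j s) *\<^sub>R f i s)" for s
  proof -
    have "insert k I - {i} = insert k (I - {i})" if "i \<in> I" for i
      using that insert.hyps by auto
    then have "(\<Sum>i\<in>I. (\<Prod>j\<in>insert k I - {i}. F j s) *\<^sub>R f i s) = F k s *\<^sub>R (\<Sum>i\<in>I. (\<Prod>j\<in>I - {i}. F j s) *\<^sub>R f i s)"
      using insert.hyps by (simp add: scaleR_sum_right)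
    moreover have "insert k I - {k} = I" using insert.hyps by auto
    ultimately show ?thesis using insert.hyps by (simp add: add.commute)
  qed
  ultimately show ?case using insert.hyps by simp
qed

end

text \<open>
  Permutations are grouped by the index \<open>k\<close> that ends up last.  What precedes is then a permutation of
  the list without its \<open>k\<close>-th entry, enumerated with the last entry moved to position \<open>k\<close>.
\<close>

lemma sum_permute_list_by_last:
  assumes "length xs = Suc m"
  shows "(\<Sum>\<sigma> | \<sigma> permutes {..<Suc m}. g (permute_list \<sigma> xs)) =
    (\<Sum>k<Suc m. \<Sum>\<sigma> | \<sigma> permutes {..<m}. g (permute_list \<sigma> (butlast (xs[k := last xs])) @ [xs ! k]))"
proof -
  have "(\<Sum>\<sigma> | \<sigma> permutes {..<Suc m}. g (permute_list \<sigma> xs)) =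
      (\<Sum>k\<in>insert m {..<m}. \<Sum>\<sigma> | \<sigma> permutes {..<m}. g (permute_list (Transposition.transpose m k \<circ> \<sigma>) xs))"
    unfolding lessThan_Suc by (rule sum_over_permutations_insert) auto
  also have "\<dots> = (\<Sum>k<Suc m. \<Sum>\<sigma> | \<sigma> permutes {..<m}. g (permute_list \<sigma> (butlast (xs[k := last xs])) @ [xs ! k]))"
    unfolding lessThan_Suc[symmetric]
  proof (intro sum.cong refl, clarify)
    fix k \<sigma> assume k: "k < Suc m" and \<sigma>: "\<sigma> permutes {..<m}"
    have "\<sigma> m = m" using permutes_not_in[OF \<sigma>, of m] by simp
    have lt: "\<sigma> i < m" if "i < m" for i using permutes_in_image[OF \<sigma>, of i] that by simp
    have "permute_list (Transposition.transpose m k \<circ> \<sigma>) xs = permute_list \<sigma> (butlast (xs[k := last xs])) @ [xs ! k]"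
    proof (rule nth_equalityI)
      fix i assume "i < length (permute_list (Transposition.transpose m k \<circ> \<sigma>) xs)"
      then have i: "i < Suc m" using assms by simp
      have "last xs = xs ! m" using assms by (metis diff_Suc_1 last_conv_nth list.size(3) nat.distinct(1))
      then show "permute_list (Transposition.transpose m k \<circ> \<sigma>) xs ! i =
          (permute_list \<sigma> (butlast (xs[k := last xs])) @ [xs ! k]) ! i"
        using i k assms \<open>\<sigma> m = m\<close> lt[of i]
        by (cases "i = m") (auto simp: permute_list_def nth_append nth_butlast nth_list_update
              Transposition.transpose_def)
    qed (use assms in simp)
    then show "g (permute_list (Transposition.transpose m k \<circ> \<sigma>) xs) =
        g (permute_list \<sigma> (butlast (xs[k := last xs])) @ [xs ! k])" by simp
  qed
  finally show ?thesis .
qed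

lemma prod_butlast_list_update:
  fixes f :: "'b \<Rightarrow> 'c::comm_monoid_mult"
  assumes "length xs = Suc m" "k < Suc m"
  shows "(\<Prod>i<m. f (butlast (xs[k := last xs]) ! i)) = (\<Prod>i\<in>{..<Suc m} - {k}. f (xs ! i))"
proof -
  have last: "last xs = xs ! m" using assms by (metis diff_Suc_1 last_conv_nth list.size(3) nat.distinct(1))
  show ?thesis
  proof (rule prod.reindex_bij_witness[of _ "\<lambda>i. if i = m then k else i" "\<lambda>i. if i = k then m else i"])
    fix i assume "i \<in> {..<m}"
    then show "f (xs ! (if i = k then m else i)) = f (butlast (xs[k := last xs]) ! i)"
      using assms last by (auto simp: nth_butlast nth_list_update)
  qed (use assms in \<open>auto split: if_splits\<close>)
qed

context young_control
begin

text \<open>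
  Both sides vanish at \<open>0\<close> and, by induction on the degree, are primitives of the same integrand:
  grouping the permutations by the last letter gives on the left the terms of the product rule
  on the right.
\<close>

lemma sum_permutations_signature_form:
  assumes "0 \<le> t" "t \<le> T"
  shows "(\<Sum>\<sigma> | \<sigma> permutes {..<length \<phi>s}. signature_form (permute_list \<sigma> \<phi>s) t) =
    (\<Prod>i<length \<phi>s. increment_form (\<phi>s ! i) t)"
  using assms
proof (induction "length \<phi>s" arbitrary: \<phi>s t)
  case 0
  then show ?case by (simp add: signature_form_Nil)
next
  case (Suc m)
  note len = Suc.hyps(2)[symmetric]
  \<comment> \<open>Up to order, \<open>\<psi> k\<close> is \<open>\<phi>s\<close> without its \<open>k\<close>-th entry.\<close>
  define \<psi> where "\<psi> k = butlast (\<phi>s[k := last \<phi>s])" for k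
  have len\<psi>: "length (\<psi> k) = m" for k by (simp add: \<psi>_def len)
  let ?L = "\<lambda>t. \<Sum>k<Suc m. \<Sum>\<sigma> | \<sigma> permutes {..<m}. signature_form (permute_list \<sigma> (\<psi> k) @ [\<phi>s ! k]) t"
  let ?R = "\<lambda>t. \<Prod>i<Suc m. increment_form (\<phi>s ! i) t"
  let ?f = "\<lambda>s. \<Sum>k<Suc m. (\<Prod>i\<in>{..<Suc m} - {k}. increment_form (\<phi>s ! i) s) *\<^sub>R (\<phi>s ! k)"
  have "young_primitive (\<lambda>s. \<Sum>k<Suc m. \<Sum>\<sigma> | \<sigma> permutes {..<m}. signature_form (permute_list \<sigma> (\<psi> k)) s *\<^sub>R (\<phi>s ! k)) ?L"
    by (intro young_primitive_sum signature_form_snoc_primitive)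
  then have L: "young_primitive ?f ?L"
  proof (rule young_primitive_cong)
    fix s assume s: "0 \<le> s" "s \<le> T"
    show "(\<Sum>k<Suc m. \<Sum>\<sigma> | \<sigma> permutes {..<m}. signature_form (permute_list \<sigma> (\<psi> k)) s *\<^sub>R (\<phi>s ! k)) = ?f s"
    proof (rule sum.cong[OF refl])
      fix k assume k: "k \<in> {..<Suc m}"
      have "(\<Sum>\<sigma> | \<sigma> permutes {..<m}. signature_form (permute_list \<sigma> (\<psi> k)) s) =
          (\<Prod>i<m. increment_form (\<psi> k ! i) s)"
        using Suc.hyps(1)[of "\<psi> k" s] s len\<psi> by simp
      also have "\<dots> = (\<Prod>i\<in>{..<Suc m} - {k}. increment_form (\<phi>s ! i) s)"
        unfolding \<psi>_def using prod_butlast_list_update[OF len] k by simp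
      finally show "(\<Sum>\<sigma> | \<sigma> permutes {..<m}. signature_form (permute_list \<sigma> (\<psi> k)) s *\<^sub>R (\<phi>s ! k)) =
          (\<Prod>i\<in>{..<Suc m} - {k}. increment_form (\<phi>s ! i) s) *\<^sub>R (\<phi>s ! k)"
        by (simp flip: scaleR_sum_left)
    qed
  qed simp
  have R: "young_primitive ?f ?R"
    using increment_form_controlled by (intro young_primitive_prod increment_form_primitive) auto
  have "?L t - ?L 0 = ?R t - ?R 0"
    using young_integral_eq[OF L Suc.prems] young_integral_eq[OF R Suc.prems] by simp
  moreover have "?L 0 = 0" by (simp add: signature_form_snoc_zero)
  moreover have "?R 0 = 0" by (simp add: increment_form_def blinfun.zero_right)
  ultimately have "?L t = ?R t" by simp
  then show ?case
    by (simp only: len sum_permute_list_by_last[OF len, of "\<lambda>xs. signature_form xs t"] \<psi>_def)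
qed

end

section \<open>The winding series\<close>

text \<open>
  The sum in a pairing ranges over the support of the dual tensor, so it is linear only after
  extension to a common finite set of words.
\<close>

lemma pairing_T_tensor:
  fixes x\<^sub>1 x\<^sub>2 :: "'a::euclidean_space \<Rightarrow>\<^sub>L real"
  shows "pairing (T_tensor x\<^sub>1 x\<^sub>2 c\<^sub>1 c\<^sub>2 j11 j12 j21 j22) X = c\<^sub>1 ^ j12 * c\<^sub>2 ^ j21 *
     ((\<Sum>\<sigma> | \<sigma> permutes {..<j11 + j22 + 1}.
          pairing (dual_tensor (permute_list \<sigma> (replicate (j11 + 1) x\<^sub>1 @ replicate j22 x\<^sub>2) @ [x\<^sub>2])) X)
      - (\<Sum>\<sigma> | \<sigma> permutes {..<j11 + j22 + 1}.
          pairing (dual_tensor (permute_list \<sigma> (replicate j11 x\<^sub>1 @ replicate (j22 + 1) x\<^sub>2) @ [x\<^sub>1])) X)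
      + c\<^sub>1 * (\<Sum>\<sigma> | \<sigma> permutes {..<j11 + j22}.
          pairing (dual_tensor (permute_list \<sigma> (replicate j11 x\<^sub>1 @ replicate j22 x\<^sub>2) @ [x\<^sub>2])) X)
      - c\<^sub>2 * (\<Sum>\<sigma> | \<sigma> permutes {..<j11 + j22}.
          pairing (dual_tensor (permute_list \<sigma> (replicate j11 x\<^sub>1 @ replicate j22 x\<^sub>2) @ [x\<^sub>1])) X))"
proof -
  let ?W = "{w. set w \<subseteq> (Basis :: 'a set) \<and> length w \<le> j11 + j22 + 2}"
  define P where "P \<tau> = (\<Sum>w\<in>?W. \<tau> w * X w)" for \<tau> :: "'a tensor"
  have pairing: "pairing \<tau> X = P \<tau>" if "\<And>w. j11 + j22 + 2 < length w \<Longrightarrow> \<tau> w = 0" for \<tau>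
    unfolding pairing_def P_def
  proof (rule sum.mono_neutral_left)
    show "finite ?W" by (rule finite_lists_length_le) simp
    show "{w. set w \<subseteq> Basis \<and> \<tau> w \<noteq> 0} \<subseteq> ?W" using that not_less by blast
  qed auto
  have P_add: "P (\<lambda>w. \<sigma> w + \<tau> w) = P \<sigma> + P \<tau>" and P_diff: "P (\<lambda>w. \<sigma> w - \<tau> w) = P \<sigma> - P \<tau>"
    and P_cmult: "P (\<lambda>w. c * \<tau> w) = c * P \<tau>" for \<sigma> \<tau> c
    by (simp_all add: P_def sum.distrib sum_subtractf sum_distrib_left algebra_simps)
  have P_sum: "P (\<lambda>w. \<Sum>i\<in>I. \<tau> i w) = (\<Sum>i\<in>I. P (\<tau> i))" for I and \<tau> :: "(nat \<Rightarrow> nat) \<Rightarrow> 'a tensor"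
    unfolding P_def by (simp add: sum_distrib_right) (rule sum.swap)
  have dual: "pairing (dual_tensor \<phi>s) X = P (dual_tensor \<phi>s)" if "length \<phi>s \<le> j11 + j22 + 2" for \<phi>s
    using that by (intro pairing) (auto simp: dual_tensor_def)
  have "pairing (T_tensor x\<^sub>1 x\<^sub>2 c\<^sub>1 c\<^sub>2 j11 j12 j21 j22) X = P (T_tensor x\<^sub>1 x\<^sub>2 c\<^sub>1 c\<^sub>2 j11 j12 j21 j22)"
    by (intro pairing) (auto simp: T_tensor_def dual_tensor_def)
  then show ?thesis
    unfolding T_tensor_def sum_subtractf P_add P_diff P_cmult P_sum
    by (simp add: dual)
qed

lemma sum_antidiagonal_binomial:
  fixes a b :: real
  shows "(\<Sum>(i, j)\<in>{(i, j). i + j = n}. fact n / (fact i * fact j) * (a ^ i * b ^ j)) = (a + b) ^ n"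
proof -
  have "(a + b) ^ n = (\<Sum>i\<le>n. fact n / (fact i * fact (n - i)) * (a ^ i * b ^ (n - i)))"
    unfolding binomial_ring by (intro sum.cong) (auto simp: binomial_fact mult.assoc)
  also have "\<dots> = (\<Sum>(i, j)\<in>{(i, j). i + j = n}. fact n / (fact i * fact j) * (a ^ i * b ^ j))"
    by (rule sum.reindex_bij_witness[of _ fst "\<lambda>i. (i, n - i)"]) auto
  finally show ?thesis ..
qed

text \<open>
  The binomial theorem is used three times: for the powers of \<open>z\<^sub>i + c\<^sub>i\<close>, for the \<open>k\<close>-th power of the
  sum of the two squares, and for the \<open>n\<close>-th power of \<open>1\<close> minus that sum.
\<close>

lemma geometric_power_expansion:
  fixes z\<^sub>1 z\<^sub>2 c\<^sub>1 c\<^sub>2 :: real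
  shows "(\<Sum>k\<le>n. (-1) ^ k * real (n choose k) *
       (\<Sum>(k\<^sub>1, k\<^sub>2) \<in> {(k\<^sub>1, k\<^sub>2). k\<^sub>1 + k\<^sub>2 = k}. fact k / (fact k\<^sub>1 * fact k\<^sub>2) *
         (\<Sum>((j11, j12), (j21, j22)) \<in> {(j11, j12). j11 + j12 = 2 * k\<^sub>1} \<times> {(j21, j22). j21 + j22 = 2 * k\<^sub>2}.
           fact (2 * k\<^sub>1) / (fact j11 * fact j12) * (fact (2 * k\<^sub>2) / (fact j21 * fact j22)) *
           (c\<^sub>1 ^ j12 * c\<^sub>2 ^ j21 * (z\<^sub>1 ^ j11 * z\<^sub>2 ^ j22))))) =
    (1 - ((z\<^sub>1 + c\<^sub>1)\<^sup>2 + (z\<^sub>2 + c\<^sub>2)\<^sup>2)) ^ n"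
proof -
  let ?D = "\<lambda>n::nat. {(i, j). i + j = n}"
  have inner: "(\<Sum>((j11, j12), (j21, j22)) \<in> ?D (2 * k\<^sub>1) \<times> ?D (2 * k\<^sub>2).
      fact (2 * k\<^sub>1) / (fact j11 * fact j12) * (fact (2 * k\<^sub>2) / (fact j21 * fact j22)) *
      (c\<^sub>1 ^ j12 * c\<^sub>2 ^ j21 * (z\<^sub>1 ^ j11 * z\<^sub>2 ^ j22))) = ((z\<^sub>1 + c\<^sub>1)\<^sup>2) ^ k\<^sub>1 * ((z\<^sub>2 + c\<^sub>2)\<^sup>2) ^ k\<^sub>2"
    (is "?S = _") for k\<^sub>1 k\<^sub>2
  proof -
    have "?S = (\<Sum>p\<in>?D (2 * k\<^sub>1). \<Sum>q\<in>?D (2 * k\<^sub>2).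
        (\<lambda>(i, j). fact (2 * k\<^sub>1) / (fact i * fact j) * (z\<^sub>1 ^ i * c\<^sub>1 ^ j)) p *
        (\<lambda>(i, j). fact (2 * k\<^sub>2) / (fact i * fact j) * (c\<^sub>2 ^ i * z\<^sub>2 ^ j)) q)"
      unfolding sum.cartesian_product by (intro sum.cong refl) (auto simp: field_simps)
    also have "\<dots> = (z\<^sub>1 + c\<^sub>1) ^ (2 * k\<^sub>1) * (c\<^sub>2 + z\<^sub>2) ^ (2 * k\<^sub>2)"
      unfolding sum_product[symmetric] sum_antidiagonal_binomial ..
    finally show ?thesis by (simp add: power_mult add.commute)
  qed
  have "(1 - ((z\<^sub>1 + c\<^sub>1)\<^sup>2 + (z\<^sub>2 + c\<^sub>2)\<^sup>2)) ^ n = (\<Sum>k\<le>n. real (n choose k) * (- ((z\<^sub>1 + c\<^sub>1)\<^sup>2 + (z\<^sub>2 + c\<^sub>2)\<^sup>2)) ^ k)"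
    unfolding diff_conv_add_uminus[of 1] add.commute[of 1] binomial_ring by simp
  also have "\<dots> = (\<Sum>k\<le>n. (-1) ^ k * real (n choose k) * ((z\<^sub>1 + c\<^sub>1)\<^sup>2 + (z\<^sub>2 + c\<^sub>2)\<^sup>2) ^ k)"
    by (intro sum.cong refl) (subst power_minus, simp add: mult_ac)
  finally show ?thesis
    unfolding inner sum_antidiagonal_binomial by (rule sym)
qed

context young_control
begin

lemma sum_permutations_snoc_primitive:
  "young_primitive (\<lambda>s. (increment_form x\<^sub>1 s ^ a * increment_form x\<^sub>2 s ^ b) *\<^sub>R \<phi>)
     (\<lambda>t. \<Sum>\<sigma> | \<sigma> permutes {..<a + b}.
        signature_form (permute_list \<sigma> (replicate a x\<^sub>1 @ replicate b x\<^sub>2) @ [\<phi>]) t)"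
proof -
  let ?l = "replicate a x\<^sub>1 @ replicate b x\<^sub>2"
  have "young_primitive (\<lambda>s. \<Sum>\<sigma> | \<sigma> permutes {..<a + b}. signature_form (permute_list \<sigma> ?l) s *\<^sub>R \<phi>)
      (\<lambda>t. \<Sum>\<sigma> | \<sigma> permutes {..<a + b}. signature_form (permute_list \<sigma> ?l @ [\<phi>]) t)"
    by (intro young_primitive_sum signature_form_snoc_primitive)
  then show ?thesis
  proof (rule young_primitive_cong)
    fix s assume s: "0 \<le> s" "s \<le> T"
    have "(\<Sum>\<sigma> | \<sigma> permutes {..<a + b}. signature_form (permute_list \<sigma> ?l) s) =
        (\<Prod>i<length ?l. increment_form (?l ! i) s)"
      using sum_permutations_signature_form[OF s, of ?l] by simp
    also have "\<dots> = prod_list (map (\<lambda>\<phi>. increment_form \<phi> s) ?l)"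
      by (simp add: prod.list_conv_set_nth lessThan_atLeast0 del: map_append)
    also have "\<dots> = increment_form x\<^sub>1 s ^ a * increment_form x\<^sub>2 s ^ b"
      by (simp add: prod_list_replicate)
    finally show "(\<Sum>\<sigma> | \<sigma> permutes {..<a + b}. signature_form (permute_list \<sigma> ?l) s *\<^sub>R \<phi>) =
        (increment_form x\<^sub>1 s ^ a * increment_form x\<^sub>2 s ^ b) *\<^sub>R \<phi>"
      by (simp flip: scaleR_sum_left)
  qed simp
qed

lemma pairing_T_tensor_zero: "pairing (T_tensor x\<^sub>1 x\<^sub>2 c\<^sub>1 c\<^sub>2 j11 j12 j21 j22) (signature 0 \<gamma>) = 0"
  unfolding pairing_T_tensor signature_form_def[symmetric] signature_form_snoc_zero by simp

text \<open>
  The four sums in the tensor are the four terms of \<open>(z\<^sub>1 + c\<^sub>1) dx\<^sub>2 - (z\<^sub>2 + c\<^sub>2) dx\<^sub>1\<close>, where \<open>z\<^sub>i\<close> is the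
  increment of \<open>x\<^sub>i(\<gamma>)\<close>: the factors \<open>z\<^sub>i\<close> raise the degree of the monomial by one, the
  factors \<open>c\<^sub>i\<close> leave it.
\<close>

lemma pairing_T_tensor_primitive:
  "young_primitive
     (\<lambda>s. (c\<^sub>1 ^ j12 * c\<^sub>2 ^ j21 * (increment_form x\<^sub>1 s ^ j11 * increment_form x\<^sub>2 s ^ j22)) *\<^sub>R
        ((increment_form x\<^sub>1 s + c\<^sub>1) *\<^sub>R x\<^sub>2 - (increment_form x\<^sub>2 s + c\<^sub>2) *\<^sub>R x\<^sub>1))
     (\<lambda>t. pairing (T_tensor x\<^sub>1 x\<^sub>2 c\<^sub>1 c\<^sub>2 j11 j12 j21 j22) (signature t \<gamma>))"
proof -
  note S = sum_permutations_snoc_primitive[of x\<^sub>1 _ x\<^sub>2]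
  have "young_primitive
     (\<lambda>s. (c\<^sub>1 ^ j12 * c\<^sub>2 ^ j21) *\<^sub>R
       ((increment_form x\<^sub>1 s ^ (j11 + 1) * increment_form x\<^sub>2 s ^ j22) *\<^sub>R x\<^sub>2
        - (increment_form x\<^sub>1 s ^ j11 * increment_form x\<^sub>2 s ^ (j22 + 1)) *\<^sub>R x\<^sub>1
        + c\<^sub>1 *\<^sub>R ((increment_form x\<^sub>1 s ^ j11 * increment_form x\<^sub>2 s ^ j22) *\<^sub>R x\<^sub>2)
        - c\<^sub>2 *\<^sub>R ((increment_form x\<^sub>1 s ^ j11 * increment_form x\<^sub>2 s ^ j22) *\<^sub>R x\<^sub>1)))
     (\<lambda>t. pairing (T_tensor x\<^sub>1 x\<^sub>2 c\<^sub>1 c\<^sub>2 j11 j12 j21 j22) (signature t \<gamma>))"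
    unfolding pairing_T_tensor signature_form_def[symmetric]
    using S[of "j11 + 1" j22 x\<^sub>2] S[of j11 "j22 + 1" x\<^sub>1]
    by (intro young_primitive_cmult young_primitive_add young_primitive_diff S) (simp_all add: ac_simps)
  then show ?thesis
    by (rule young_primitive_cong) (simp_all add: algebra_simps)
qed

lemma winding_series_term_zero: "winding_series_term 0 \<gamma> x\<^sub>1 x\<^sub>2 \<xi>\<^sub>1 \<xi>\<^sub>2 n = 0"
  by (simp add: winding_series_term_def pairing_T_tensor_zero split_beta)

lemma winding_series_term_primitive:
  fixes x\<^sub>1 x\<^sub>2 :: "'a \<Rightarrow>\<^sub>L real"
  shows "young_primitive
     (\<lambda>s. (1 - ((x\<^sub>1 (\<gamma> s) - \<xi>\<^sub>1)\<^sup>2 + (x\<^sub>2 (\<gamma> s) - \<xi>\<^sub>2)\<^sup>2)) ^ n *\<^sub>R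
        ((x\<^sub>1 (\<gamma> s) - \<xi>\<^sub>1) *\<^sub>R x\<^sub>2 - (x\<^sub>2 (\<gamma> s) - \<xi>\<^sub>2) *\<^sub>R x\<^sub>1))
     (\<lambda>t. winding_series_term t \<gamma> x\<^sub>1 x\<^sub>2 \<xi>\<^sub>1 \<xi>\<^sub>2 n)"
proof -
  define c\<^sub>1 where "c\<^sub>1 = x\<^sub>1 (\<gamma> 0) - \<xi>\<^sub>1"
  define c\<^sub>2 where "c\<^sub>2 = x\<^sub>2 (\<gamma> 0) - \<xi>\<^sub>2"
  define z\<^sub>1 where "z\<^sub>1 = increment_form x\<^sub>1"
  define z\<^sub>2 where "z\<^sub>2 = increment_form x\<^sub>2"
  define \<eta> where "\<eta> s = (z\<^sub>1 s + c\<^sub>1) *\<^sub>R x\<^sub>2 - (z\<^sub>2 s + c\<^sub>2) *\<^sub>R x\<^sub>1" for s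
  have y: "x\<^sub>1 (\<gamma> s) - \<xi>\<^sub>1 = z\<^sub>1 s + c\<^sub>1" "x\<^sub>2 (\<gamma> s) - \<xi>\<^sub>2 = z\<^sub>2 s + c\<^sub>2" for s
    by (simp_all add: z\<^sub>1_def z\<^sub>2_def c\<^sub>1_def c\<^sub>2_def increment_form_def blinfun.diff_right)
  note prim = pairing_T_tensor_primitive[where x\<^sub>1 = x\<^sub>1 and x\<^sub>2 = x\<^sub>2,
      folded z\<^sub>1_def z\<^sub>2_def, of c\<^sub>1 _ c\<^sub>2, folded \<eta>_def]
  have "young_primitive
     (\<lambda>s. \<Sum>k\<le>n. ((-1) ^ k * real (n choose k)) *\<^sub>R
       (\<Sum>(k\<^sub>1, k\<^sub>2) \<in> {(k\<^sub>1, k\<^sub>2). k\<^sub>1 + k\<^sub>2 = k}. (fact k / (fact k\<^sub>1 * fact k\<^sub>2)) *\<^sub>R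
         (\<Sum>((j11, j12), (j21, j22)) \<in> {(j11, j12). j11 + j12 = 2 * k\<^sub>1} \<times> {(j21, j22). j21 + j22 = 2 * k\<^sub>2}.
           (fact (2 * k\<^sub>1) / (fact j11 * fact j12) * (fact (2 * k\<^sub>2) / (fact j21 * fact j22))) *\<^sub>R
           ((c\<^sub>1 ^ j12 * c\<^sub>2 ^ j21 * (z\<^sub>1 s ^ j11 * z\<^sub>2 s ^ j22)) *\<^sub>R \<eta> s))))
     (\<lambda>t. winding_series_term t \<gamma> x\<^sub>1 x\<^sub>2 \<xi>\<^sub>1 \<xi>\<^sub>2 n)"
    unfolding winding_series_term_def split_beta c\<^sub>1_def[symmetric] c\<^sub>2_def[symmetric]
    by (intro young_primitive_sum young_primitive_cmult prim)
  then have "young_primitive (\<lambda>s. (1 - ((z\<^sub>1 s + c\<^sub>1)\<^sup>2 + (z\<^sub>2 s + c\<^sub>2)\<^sup>2)) ^ n *\<^sub>R \<eta> s)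
      (\<lambda>t. winding_series_term t \<gamma> x\<^sub>1 x\<^sub>2 \<xi>\<^sub>1 \<xi>\<^sub>2 n)"
    unfolding geometric_power_expansion[symmetric] scaleR_sum_left scaleR_scaleR[symmetric] split_beta .
  then show ?thesis by (simp only: y \<eta>_def)
qed

lemma controlled_power:
  fixes q :: "real \<Rightarrow> real"
  assumes q: "controlled D q" and \<rho>: "\<And>t. 0 \<le> t \<Longrightarrow> t \<le> T \<Longrightarrow> \<bar>q t\<bar> \<le> \<rho>"
  shows "controlled (real n * \<rho> ^ (n - 1) * D) (\<lambda>t. q t ^ n)"
proof (induction n)
  case 0
  then show ?case by (simp add: controlled_const)
next
  case (Suc n)
  have "controlled (\<rho> * (real n * \<rho> ^ (n - 1) * D) + \<rho> ^ n * D) (\<lambda>t. q t *\<^sub>R q t ^ n)"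
    by (rule controlled_scaleR[OF q Suc \<rho>]) (auto simp: power_abs intro!: power_mono \<rho>)
  moreover have "\<rho> * (real n * \<rho> ^ (n - 1) * D) + \<rho> ^ n * D = real (Suc n) * \<rho> ^ n * D"
    by (cases n) (simp_all add: algebra_simps)
  ultimately show ?case by simp
qed

lemma controlled_inverse:
  fixes q :: "real \<Rightarrow> real"
  assumes q: "controlled D q" and m: "0 < m" "\<And>t. 0 \<le> t \<Longrightarrow> t \<le> T \<Longrightarrow> m \<le> q t"
  shows "controlled (D / m\<^sup>2) (\<lambda>t. 1 / q t)"
proof (rule controlledI)
  show "0 \<le> D / m\<^sup>2" using controlledD(1)[OF q] by simp
  fix u v assume uv: "0 \<le> u" "u \<le> v" "v \<le> T"
  have pos: "m \<le> q u" "m \<le> q v" using uv m by auto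
  have "1 / q v - 1 / q u = (q u - q v) / (q u * q v)"
    using pos m(1) by (simp add: field_simps)
  then have "norm (1 / q v - 1 / q u) = \<bar>q v - q u\<bar> / (q u * q v)"
    using pos m(1) by (simp add: abs_mult abs_minus_commute)
  also have "\<dots> \<le> (D * \<omega> u v powr (\<theta> / 2)) / m\<^sup>2"
    using controlledD(2)[OF q uv] pos m(1) unfolding power2_eq_square
    by (intro frac_le mult_mono) auto
  finally show "norm (1 / q v - 1 / q u) \<le> D / m\<^sup>2 * \<omega> u v powr (\<theta> / 2)" by simp
qed

text \<open>
  The partial sums of the series differ from the winding integral by the integral of
  \<open>(1 - r) ^ N *\<^sub>R \<kappa>\<close>, where \<open>\<kappa>\<close> is the winding form along the path.  The path being
  closed, the first order term of the estimate for this integral vanishes, and the constant in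
  the second order term is \<open>A N\<close>, which tends to \<open>0\<close>.
\<close>

lemma winding_series_sums:
  fixes x\<^sub>1 x\<^sub>2 :: "'a \<Rightarrow>\<^sub>L real"
  assumes closed: "\<gamma> 0 = \<gamma> T" and \<rho>: "0 \<le> \<rho>" "\<rho> < 1"
    and annulus: "\<And>t. 0 \<le> t \<Longrightarrow> t \<le> T \<Longrightarrow>
      \<bar>1 - ((x\<^sub>1 (\<gamma> t) - \<xi>\<^sub>1)\<^sup>2 + (x\<^sub>2 (\<gamma> t) - \<xi>\<^sub>2)\<^sup>2)\<bar> \<le> \<rho>"
  shows "winding_series_term T \<gamma> x\<^sub>1 x\<^sub>2 \<xi>\<^sub>1 \<xi>\<^sub>2 sums line_integral T \<gamma> (winding_form x\<^sub>1 x\<^sub>2 \<xi>\<^sub>1 \<xi>\<^sub>2)"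
proof -
  define r where "r t = (x\<^sub>1 (\<gamma> t) - \<xi>\<^sub>1)\<^sup>2 + (x\<^sub>2 (\<gamma> t) - \<xi>\<^sub>2)\<^sup>2" for t
  define \<eta> where "\<eta> t = (x\<^sub>1 (\<gamma> t) - \<xi>\<^sub>1) *\<^sub>R x\<^sub>2 - (x\<^sub>2 (\<gamma> t) - \<xi>\<^sub>2) *\<^sub>R x\<^sub>1" for t
  define \<kappa> where "\<kappa> t = (1 / r t) *\<^sub>R \<eta> t" for t
  have q: "\<bar>1 - r t\<bar> \<le> \<rho>" if "0 \<le> t" "t \<le> T" for t
    using annulus[OF that] by (simp add: r_def)
  have r: "1 - \<rho> \<le> r t" if "0 \<le> t" "t \<le> T" for t using q[OF that] by linarith
  have cy: "\<exists>A. controlled A (\<lambda>t. blinfun_apply x (\<gamma> t) - \<xi>)" for x :: "'a \<Rightarrow>\<^sub>L real" and \<xi> :: real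
    using ex_controlled_add[of "\<lambda>t. blinfun_apply x (\<gamma> t)" "\<lambda>_. - \<xi>"] controlled_linear_form controlled_const
    by auto
  have ctl_r: "\<exists>A. controlled A r"
    unfolding r_def power2_eq_square using ex_controlled_scaleR[OF cy cy] by (intro ex_controlled_add) auto
  have "\<exists>A. controlled A (\<lambda>t. 1 + (-1) *\<^sub>R r t)"
    using ctl_r controlled_const by (intro ex_controlled_add ex_controlled_cmult) auto
  then obtain D where D: "controlled D (\<lambda>t. 1 - r t)" by auto
  have "\<exists>A. controlled A (\<lambda>t. (x\<^sub>1 (\<gamma> t) - \<xi>\<^sub>1) *\<^sub>R x\<^sub>2 + (x\<^sub>2 (\<gamma> t) - \<xi>\<^sub>2) *\<^sub>R - x\<^sub>1)"
    using cy controlled_const by (intro ex_controlled_add ex_controlled_scaleR) auto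
  then have ctl_\<eta>: "\<exists>A. controlled A \<eta>" unfolding \<eta>_def by simp
  have "\<exists>A. controlled A (\<lambda>t. 1 / r t)"
    using ctl_r controlled_inverse[of _ r "1 - \<rho>"] r \<rho> by auto
  then have "\<exists>A. controlled A \<kappa>"
    unfolding \<kappa>_def using ctl_\<eta> by (intro ex_controlled_scaleR)
  then obtain B where B: "controlled B \<kappa>" ..
  define M where "M = norm (\<kappa> 0) + B * \<omega> 0 T powr (\<theta> / 2)"
  define A where "A N = \<rho> ^ N * B + M * (real N * \<rho> ^ (N - 1) * D)" for N
  have remainder: "controlled (A N) (\<lambda>t. (1 - r t) ^ N *\<^sub>R \<kappa> t)" for N
    unfolding A_def
  proof (rule controlled_scaleR[OF controlled_power[OF D q] B])
    fix t assume t: "0 \<le> t" "t \<le> T"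
    show "\<bar>(1 - r t) ^ N\<bar> \<le> \<rho> ^ N" unfolding power_abs using q[OF t] by (intro power_mono) auto
    show "norm (\<kappa> t) \<le> M" unfolding M_def using controlled_bounded[OF B t] .
  qed
  obtain G where G: "young_primitive \<kappa> G" using young_primitive_exists[OF B] by blast
  have integral: "line_integral T \<gamma> (winding_form x\<^sub>1 x\<^sub>2 \<xi>\<^sub>1 \<xi>\<^sub>2) = G T - G 0"
    using young_integral_eq[OF G T_nonneg order_refl]
    by (simp add: line_integral_def winding_form_def \<kappa>_def[abs_def] r_def \<eta>_def)
  let ?w = "\<lambda>t n. winding_series_term t \<gamma> x\<^sub>1 x\<^sub>2 \<xi>\<^sub>1 \<xi>\<^sub>2 n"
  have bound: "\<bar>(\<Sum>n<N. ?w T n) - (G T - G 0)\<bar> \<le> sewing_constant * A N * \<omega> 0 T powr \<theta>" for N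
  proof -
    have "young_primitive (\<lambda>s. \<kappa> s - (\<Sum>n<N. (1 - r s) ^ n *\<^sub>R \<eta> s)) (\<lambda>t. G t - (\<Sum>n<N. ?w t n))"
      using G winding_series_term_primitive unfolding r_def \<eta>_def
      by (intro young_primitive_diff young_primitive_sum)
    then have "young_primitive (\<lambda>s. (1 - r s) ^ N *\<^sub>R \<kappa> s) (\<lambda>t. G t - (\<Sum>n<N. ?w t n))"
    proof (rule young_primitive_cong)
      fix s assume s: "0 \<le> s" "s \<le> T"
      have "r s \<noteq> 0" using r[OF s] \<rho> by auto
      then have "\<eta> s = (1 - (1 - r s)) *\<^sub>R \<kappa> s" by (simp add: \<kappa>_def)
      then have "(\<Sum>n<N. (1 - r s) ^ n *\<^sub>R \<eta> s) = ((1 - (1 - r s)) * (\<Sum>n<N. (1 - r s) ^ n)) *\<^sub>R \<kappa> s"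
        by (simp add: mult.commute sum_distrib_left flip: scaleR_sum_left)
      also have "\<dots> = (1 - (1 - r s) ^ N) *\<^sub>R \<kappa> s"
        by (simp only: one_diff_power_eq)
      finally show "\<kappa> s - (\<Sum>n<N. (1 - r s) ^ n *\<^sub>R \<eta> s) = (1 - r s) ^ N *\<^sub>R \<kappa> s"
        by (simp add: algebra_simps)
    qed simp
    from young_integral_estimate[OF remainder this] show ?thesis
      by (simp add: winding_series_term_zero closed blinfun.zero_right abs_minus_commute algebra_simps)
  qed
  have lim: "(\<lambda>N. sewing_constant * A N * \<omega> 0 T powr \<theta>) \<longlonglongrightarrow> sewing_constant * 0 * \<omega> 0 T powr \<theta>"
  proof (intro tendsto_intros)
    have pow: "(\<lambda>N. \<rho> ^ N) \<longlonglongrightarrow> 0" using \<rho> by (intro LIMSEQ_power_zero) auto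
    have "(\<lambda>N. real N * \<rho> ^ N + \<rho> ^ N) \<longlonglongrightarrow> 0 + 0"
      using \<rho> powser_times_n_limit_0[of \<rho>] pow by (intro tendsto_add) auto
    then have "(\<lambda>N. real (Suc N) * \<rho> ^ (Suc N - 1)) \<longlonglongrightarrow> 0" by (simp add: algebra_simps)
    then have deriv: "(\<lambda>N. real N * \<rho> ^ (N - 1)) \<longlonglongrightarrow> 0" by (rule LIMSEQ_imp_Suc)
    have "A \<longlonglongrightarrow> 0 * B + M * (0 * D)"
      unfolding A_def by (intro tendsto_intros pow deriv)
    then show "A \<longlonglongrightarrow> 0" by simp
  qed
  have "(\<lambda>N. (\<Sum>n<N. ?w T n) - (G T - G 0)) \<longlonglongrightarrow> 0"
  proof (rule Lim_null_comparison)
    show "\<forall>\<^sub>F N in sequentially.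
        norm ((\<Sum>n<N. ?w T n) - (G T - G 0)) \<le> sewing_constant * A N * \<omega> 0 T powr \<theta>"
      unfolding real_norm_def by (intro always_eventually allI bound)
    show "(\<lambda>N. sewing_constant * A N * \<omega> 0 T powr \<theta>) \<longlonglongrightarrow> 0"
      using lim unfolding mult_zero_right mult_zero_left .
  qed
  then show ?thesis
    unfolding sums_def integral by (rule LIM_zero_cancel)
qed

end

text \<open>
  By compactness of \<open>[0, T]\<close> the strict inequalities bound \<open>\<bar>1 - r\<bar>\<close> uniformly by a number less than \<open>1\<close>.
\<close>

theorem theorem1p2:
  fixes \<gamma> :: "real \<Rightarrow> 'a::euclidean_space"
    and x\<^sub>1 x\<^sub>2 :: "'a \<Rightarrow>\<^sub>L real"
    and \<xi>\<^sub>1 \<xi>\<^sub>2 p T :: real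
  assumes "0 \<le> T" and "1 \<le> p" and "p < 2"
    and "continuous_on {0..T} \<gamma>" and "\<gamma> 0 = \<gamma> T"
    and "finite_p_variation p T \<gamma>"
    and "x\<^sub>1 \<noteq> x\<^sub>2" and "independent {x\<^sub>1, x\<^sub>2}"
    and "\<And>t. t \<in> {0..T} \<Longrightarrow>
           1 / 2 < (x\<^sub>1 (\<gamma> t) - \<xi>\<^sub>1)\<^sup>2 + (x\<^sub>2 (\<gamma> t) - \<xi>\<^sub>2)\<^sup>2 \<and>
           (x\<^sub>1 (\<gamma> t) - \<xi>\<^sub>1)\<^sup>2 + (x\<^sub>2 (\<gamma> t) - \<xi>\<^sub>2)\<^sup>2 < 2"
  shows "summable (winding_series_term T \<gamma> x\<^sub>1 x\<^sub>2 \<xi>\<^sub>1 \<xi>\<^sub>2) \<and>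
         oriented_winding_number T \<gamma> x\<^sub>1 x\<^sub>2 \<xi>\<^sub>1 \<xi>\<^sub>2 =
           1 / (2 * pi) * (\<Sum>n. winding_series_term T \<gamma> x\<^sub>1 x\<^sub>2 \<xi>\<^sub>1 \<xi>\<^sub>2 n)"
proof -
  obtain \<omega> \<theta> where "young_control \<omega> T \<theta> \<gamma>"
    using ex_young_control[OF assms(1-4,6)] .
  then interpret young_control \<omega> T \<theta> \<gamma> .
  define d where "d t = \<bar>1 - ((x\<^sub>1 (\<gamma> t) - \<xi>\<^sub>1)\<^sup>2 + (x\<^sub>2 (\<gamma> t) - \<xi>\<^sub>2)\<^sup>2)\<bar>" for t
  have "continuous_on {0..T} d"
    unfolding d_def by (intro continuous_intros assms(4))
  then obtain t\<^sub>0 where t\<^sub>0: "t\<^sub>0 \<in> {0..T}" "\<And>t. t \<in> {0..T} \<Longrightarrow> d t \<le> d t\<^sub>0"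
    using continuous_attains_sup[of "{0..T}" d] assms(1) by auto
  have "0 \<le> d t\<^sub>0" "d t\<^sub>0 < 1"
    using assms(9)[OF t\<^sub>0(1)] by (auto simp: d_def abs_less_iff)
  then have "winding_series_term T \<gamma> x\<^sub>1 x\<^sub>2 \<xi>\<^sub>1 \<xi>\<^sub>2 sums line_integral T \<gamma> (winding_form x\<^sub>1 x\<^sub>2 \<xi>\<^sub>1 \<xi>\<^sub>2)"
    using winding_series_sums[OF assms(5), of "d t\<^sub>0"] t\<^sub>0(2) unfolding d_def by simp
  then show ?thesis
    unfolding oriented_winding_number_def sums_iff by simp
qed

end
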